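(* Let $\mathcal A=\{H_0,\dots,H_n\}$ be a central arrangement in $\mathbb C^{\ell+1}$, $0\le i<j\le n$, $1\le p\le\ell$, and let $\tau_{ij}:\mathcal F^p_{(i)}\to\mathcal F^p_{(j)}$ be as in the context. Let $[X_0<\cdots<X_p]\in\mathcal F^p$ with $H_i\not\le X_p$. (a) If $H_j\not\le X_p$, then $\tau_{ij}([X_0<\cdots<X_p])=[X_0<\cdots<X_p]$. (b) If $H_j\le X_p$ and $H_j\not\le X_{p-1}$, then \[ \tau_{ij}([X_0<\cdots<X_p])=-\sum_{\substack{X'\in L,\ \operatorname{codim}X'=p\\ X_{p-1}<X',\ X'\neq X_p}}[X_0<\cdots<X_{p-1}<X']. \]
   Context: $\mathcal A=\{H_0,\dots,H_n\}$ is a central arrangement of distinct hyperplanes in $\mathbb C^{\ell+1}$. $L$ is the set of intersections of subfamilies of $\mathcal A$ (including $\mathbb C^{\ell+1}$), partially ordered by reverse inclusion ($X\le Y$ iff $Y\subseteq X$; so $H\le X$ means $X\subseteq H$). A flag of length $p$ is a chain $(X_0<\cdots<X_p)$ in $L$ with $\operatorname{codim}X_r=r$. The flag space $\mathcal F=\bigoplus_p\mathcal F^p$ is the span of flags modulo all sums $\sum_Y(X_0<\cdots<X_{r-1}<Y<X_{r+1}<\cdots<X_p)$ over $Y\in L$ with $X_{r-1}<Y<X_{r+1}$, $\operatorname{codim}Y=r$; images written $[X_0<\cdots<X_p]$. The flag differential is $d[X_0<\cdots<X_p]=\sum_{X>X_p,\ \operatorname{codim}X=p+1}[X_0<\cdots<X_p<X]$,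 $\bar{\mathcal F}=\mathcal F/\operatorname{im}(d)$, $\pi:\mathcal F\to\bar{\mathcal F}$ the projection. For $X\in L$ of codimension $p$, $\mathcal F^p_X$ is the image in $\mathcal F^p$ of the span of flags ending at $X$. For each $k$ and $0\le p\le\ell$ put $\mathcal F^p_{(k)}=\bigoplus_{\operatorname{codim}X=p,\ H_k\not\le X}\mathcal F^p_X\subseteq\mathcal F^p$; the paper shows that $\pi$ restricts to an isomorphism $\mathcal F^p_{(k)}\to\bar{\mathcal F}^p$. Then $\tau_{ij}:\mathcal F^p_{(i)}\to\mathcal F^p_{(j)}$ sends $F$ to the unique element of $\mathcal F^p_{(j)}$ with the same image under $\pi$ as $F$ (this is the transition map between the dehomogenizations relative to $H_i$ and $H_j$). *)

theory Defs
  imports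
    "HOL-Analysis.Cartesian_Space"
    "HOL-Algebra.AbelCoset"
    "HOL-Algebra.Module"
begin

subsection \<open>Free modules, spans and quotient modules over \<open>\<complex>\<close>\<close>

definition CC :: "complex ring"
  where "CC = \<lparr>carrier = UNIV, monoid.mult = (*), one = 1, ring.zero = 0, add = (+)\<rparr>"

text \<open>Modules use the record type of \<^theory>\<open>HOL-Algebra.Module\<close>, whose ring multiplication and
  unit are irrelevant and left undefined.\<close>

definition free_module :: "'a set \<Rightarrow> (complex, 'a \<Rightarrow> complex) module"
  where "free_module B =
    \<lparr>carrier = {f. finite {x. f x \<noteq> 0} \<and> {x. f x \<noteq> 0} \<subseteq> B},
     monoid.mult = undefined, one = undefined,
     ring.zero = (\<lambda>x. 0), add = (\<lambda>f g x. f x + g x),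
     module.smult = (\<lambda>c f x. c * f x)\<rparr>"

definition basis_elt :: "'a \<Rightarrow> 'a \<Rightarrow> complex"
  where "basis_elt b = (\<lambda>x. if x = b then 1 else 0)"

definition span_of :: "(complex, 'a) module \<Rightarrow> 'a set \<Rightarrow> 'a set"
  where "span_of M S = \<Inter>{N. submodule N CC M \<and> S \<subseteq> N}"

text \<open>The scalar multiplication takes a union over representatives; for a submodule \<open>N\<close> all of them
  give the same coset.\<close>

definition quot_module :: "(complex, 'a) module \<Rightarrow> 'a set \<Rightarrow> (complex, 'a set) module"
  where "quot_module M N =
    \<lparr>carrier = a_rcosets\<^bsub>M\<^esub> N,
     monoid.mult = undefined, one = undefined,
     ring.zero = N, add = set_add M,
     module.smult = (\<lambda>c A. \<Union>a\<in>A. N +>\<^bsub>M\<^esub> (c \<odot>\<^bsub>M\<^esub> a))\<rparr>"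

lemma cring_CC: "cring CC"
proof (rule cringI)
  show "abelian_group CC"
  proof (rule abelian_groupI)
    fix x assume "x \<in> carrier CC"
    have "- x \<oplus>\<^bsub>CC\<^esub> x = \<zero>\<^bsub>CC\<^esub>" by (simp add: CC_def)
    moreover have "- x \<in> carrier CC" by (simp add: CC_def)
    ultimately show "\<exists>y\<in>carrier CC. y \<oplus>\<^bsub>CC\<^esub> x = \<zero>\<^bsub>CC\<^esub>" by blast
  qed (auto simp: CC_def)
  show "Group.comm_monoid CC"
    by (rule comm_monoidI) (auto simp: CC_def)
qed (auto simp: CC_def algebra_simps)

lemma module_free_module: "Module.module CC (free_module B)"
proof (rule Module.moduleI)
  show "cring CC" by (rule cring_CC)
  have add: "f \<oplus>\<^bsub>free_module B\<^esub> g \<in> carrier (free_module B)"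
    if "f \<in> carrier (free_module B)" "g \<in> carrier (free_module B)" for f g
  proof -
    have "{x. f x + g x \<noteq> 0} \<subseteq> {x. f x \<noteq> 0} \<union> {x. g x \<noteq> 0}" by auto
    then show ?thesis
      using that by (auto simp: free_module_def intro: finite_subset)
  qed
  show "abelian_group (free_module B)"
  proof (rule abelian_groupI)
    fix f assume "f \<in> carrier (free_module B)"
    then have "(\<lambda>x. - f x) \<in> carrier (free_module B)"
      and "(\<lambda>x. - f x) \<oplus>\<^bsub>free_module B\<^esub> f = \<zero>\<^bsub>free_module B\<^esub>"
      by (auto simp: free_module_def)
    then show "\<exists>g\<in>carrier (free_module B). g \<oplus>\<^bsub>free_module B\<^esub> f = \<zero>\<^bsub>free_module B\<^esub>"
      by blast
  qed (use add in \<open>simp_all add: free_module_def algebra_simps\<close>)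
  show "c \<odot>\<^bsub>free_module B\<^esub> f \<in> carrier (free_module B)"
    if "f \<in> carrier (free_module B)" for c f
    using that by (cases "c = 0") (auto simp: free_module_def)
qed (simp_all add: free_module_def CC_def algebra_simps)

lemma submodule_span_of:
  assumes "Module.module CC M" "S \<subseteq> carrier M"
  shows "submodule (span_of M S) CC M"
proof -
  interpret Module.module CC M by fact
  show ?thesis
  proof (rule submoduleI)
    show "span_of M S \<subseteq> carrier M"
      unfolding span_of_def using carrier_is_submodule assms(2) by blast
    show "\<zero>\<^bsub>M\<^esub> \<in> span_of M S"
      unfolding span_of_def
      using subgroup.one_closed[OF submodule.axioms(1)] by fastforce
  qed (auto simp: span_of_def dest: submoduleE(3-5))
qed

lemma module_quot_module:
  assumes "Module.module CC M" "submodule N CC M"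
  shows "Module.module CC (quot_module M N)"
proof -
  interpret Module.module CC M by fact
  interpret N: submodule N CC M by fact
  interpret abelian_subgroup N M
    by (rule abelian_subgroupI3)
      (auto intro: additive_subgroup.intro N.subgroup_axioms M.abelian_group_axioms)
  let ?Q = "quot_module M N"
  have carr: "carrier ?Q = (\<lambda>a. N +>\<^bsub>M\<^esub> a) ` carrier M"
    by (auto simp: quot_module_def A_RCOSETS_def')
  have add: "(N +>\<^bsub>M\<^esub> a) \<oplus>\<^bsub>?Q\<^esub> (N +>\<^bsub>M\<^esub> b) = N +>\<^bsub>M\<^esub> (a \<oplus>\<^bsub>M\<^esub> b)"
    if "a \<in> carrier M" "b \<in> carrier M" for a b
    using that by (simp add: quot_module_def a_rcos_sum)
  have zero: "\<zero>\<^bsub>?Q\<^esub> = N +>\<^bsub>M\<^esub> \<zero>\<^bsub>M\<^esub>"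
    by (simp add: quot_module_def a_coset_add_zero a_subset)
  have M_smult: "c \<odot>\<^bsub>M\<^esub> a \<in> carrier M" if "c \<in> carrier CC" "a \<in> carrier M" for c a
    using that by (rule smult_closed)
  have smult: "c \<odot>\<^bsub>?Q\<^esub> (N +>\<^bsub>M\<^esub> a) = N +>\<^bsub>M\<^esub> (c \<odot>\<^bsub>M\<^esub> a)"
    if a: "a \<in> carrier M" and c: "c \<in> carrier CC" for a c
  proof -
    have "N +>\<^bsub>M\<^esub> (c \<odot>\<^bsub>M\<^esub> b) = N +>\<^bsub>M\<^esub> (c \<odot>\<^bsub>M\<^esub> a)" if b: "b \<in> N +>\<^bsub>M\<^esub> a" for b
    proof -
      obtain h where h: "h \<in> N" "b = h \<oplus>\<^bsub>M\<^esub> a"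
        using b by (auto simp: a_r_coset_def')
      then have "c \<odot>\<^bsub>M\<^esub> b = c \<odot>\<^bsub>M\<^esub> h \<oplus>\<^bsub>M\<^esub> c \<odot>\<^bsub>M\<^esub> a"
        using a c a_subset by (auto intro: smult_r_distr)
      moreover have "c \<odot>\<^bsub>M\<^esub> h \<in> N" using h c by auto
      ultimately have "c \<odot>\<^bsub>M\<^esub> b \<in> N +>\<^bsub>M\<^esub> (c \<odot>\<^bsub>M\<^esub> a)"
        by (auto simp: a_r_coset_def')
      then show ?thesis
        using a_repr_independence[OF _ _ a_subgroup] M_smult[OF c a] by blast
    qed
    moreover have "a \<in> N +>\<^bsub>M\<^esub> a" using a by (rule a_rcos_self)
    ultimately have "(\<Union>b\<in>N +>\<^bsub>M\<^esub> a. N +>\<^bsub>M\<^esub> (c \<odot>\<^bsub>M\<^esub> b)) = N +>\<^bsub>M\<^esub> (c \<odot>\<^bsub>M\<^esub> a)"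
      by blast
    then show ?thesis by (simp add: quot_module_def)
  qed
  show ?thesis
  proof (rule Module.moduleI)
    show "cring CC" by (rule cring_CC)
    show "abelian_group ?Q"
    proof (rule abelian_groupI)
      fix x assume "x \<in> carrier ?Q"
      then obtain a where a: "a \<in> carrier M" "x = N +>\<^bsub>M\<^esub> a" by (auto simp: carr)
      then have "(N +>\<^bsub>M\<^esub> (\<ominus>\<^bsub>M\<^esub> a)) \<oplus>\<^bsub>?Q\<^esub> x = \<zero>\<^bsub>?Q\<^esub>"
        by (simp add: add zero M.l_neg)
      then show "\<exists>y\<in>carrier ?Q. y \<oplus>\<^bsub>?Q\<^esub> x = \<zero>\<^bsub>?Q\<^esub>"
        using a by (auto simp: carr)
    qed (auto simp: carr add zero M.a_ac)
  qed (auto simp: carr add smult smult_l_distr smult_r_distr smult_assoc1)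
qed


subsection \<open>Arrangements and flags\<close>

definition linear_hyperplane :: "(complex ^ 'm) set \<Rightarrow> bool"
  where "linear_hyperplane V \<longleftrightarrow> vec.subspace V \<and> vec.dim V + 1 = CARD('m)"

definition central_arrangement :: "(nat \<Rightarrow> (complex ^ 'm) set) \<Rightarrow> nat \<Rightarrow> bool"
  where "central_arrangement H n \<longleftrightarrow>
    (\<forall>k\<le>n. linear_hyperplane (H k)) \<and> inj_on H {..n}"

definition codim :: "(complex ^ 'm) set \<Rightarrow> nat"
  where "codim X = CARD('m) - vec.dim X"

text \<open>The empty subfamily contributes the whole space.\<close>

definition lat :: "(nat \<Rightarrow> (complex ^ 'm) set) \<Rightarrow> nat \<Rightarrow> (complex ^ 'm) set set"
  where "lat H n = {\<Inter>k\<in>S. H k | S. S \<subseteq> {..n}}"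

text \<open>The order of the lattice is reverse inclusion.\<close>

definition lat_le :: "'a set \<Rightarrow> 'a set \<Rightarrow> bool" (infix \<open>\<preceq>\<close> 50)
  where "X \<preceq> Y \<longleftrightarrow> Y \<subseteq> X"

definition lat_less :: "'a set \<Rightarrow> 'a set \<Rightarrow> bool" (infix \<open>\<prec>\<close> 50)
  where "X \<prec> Y \<longleftrightarrow> X \<preceq> Y \<and> X \<noteq> Y"

definition is_flag ::
    "(nat \<Rightarrow> (complex ^ 'm) set) \<Rightarrow> nat \<Rightarrow> nat \<Rightarrow> (complex ^ 'm) set list \<Rightarrow> bool"
  where "is_flag H n p Xs \<longleftrightarrow>
    length Xs = p + 1 \<and> set Xs \<subseteq> lat H n \<and> sorted_wrt (\<prec>) Xs \<and> (\<forall>r\<le>p. codim (Xs ! r) = r)"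

definition flags :: "(nat \<Rightarrow> (complex ^ 'm) set) \<Rightarrow> nat \<Rightarrow> (complex ^ 'm) set list set"
  where "flags H n = {Xs. \<exists>p. is_flag H n p Xs}"


subsection \<open>The flag space\<close>

abbreviation flag_chains ::
    "(nat \<Rightarrow> (complex ^ 'm) set) \<Rightarrow> nat \<Rightarrow> (complex, (complex ^ 'm) set list \<Rightarrow> complex) module"
  where "flag_chains H n \<equiv> free_module (flags H n)"

text \<open>Between two elements of the lattice whose codimensions differ by 2 there is always an element
  of intermediate codimension, so every chain with one gap arises from some flag \<open>Xs\<close> by
  disregarding its entry at the position \<open>r\<close>.\<close>

definition flag_relations ::
    "(nat \<Rightarrow> (complex ^ 'm) set) \<Rightarrow> nat \<Rightarrow> ((complex ^ 'm) set list \<Rightarrow> complex) set"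
  where "flag_relations H n =
    {\<Oplus>\<^bsub>flag_chains H n\<^esub> Y \<in> {Y \<in> lat H n. Xs ! (r - 1) \<prec> Y \<and> Y \<prec> Xs ! (r + 1) \<and> codim Y = r}.
       basis_elt (Xs[r := Y])
     | Xs p r. is_flag H n p Xs \<and> 0 < r \<and> r < p}"

definition flag_rel_span ::
    "(nat \<Rightarrow> (complex ^ 'm) set) \<Rightarrow> nat \<Rightarrow> ((complex ^ 'm) set list \<Rightarrow> complex) set"
  where "flag_rel_span H n = span_of (flag_chains H n) (flag_relations H n)"

definition flag_space ::
    "(nat \<Rightarrow> (complex ^ 'm) set) \<Rightarrow> nat \<Rightarrow> (complex, ((complex ^ 'm) set list \<Rightarrow> complex) set) module"
  where "flag_space H n = quot_module (flag_chains H n) (flag_rel_span H n)"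

definition flag_proj ::
    "(nat \<Rightarrow> (complex ^ 'm) set) \<Rightarrow> nat \<Rightarrow> ((complex ^ 'm) set list \<Rightarrow> complex)
      \<Rightarrow> ((complex ^ 'm) set list \<Rightarrow> complex) set"
  where "flag_proj H n c = flag_rel_span H n +>\<^bsub>flag_chains H n\<^esub> c"

definition flag_class ::
    "(nat \<Rightarrow> (complex ^ 'm) set) \<Rightarrow> nat \<Rightarrow> (complex ^ 'm) set list
      \<Rightarrow> ((complex ^ 'm) set list \<Rightarrow> complex) set"
  where "flag_class H n Xs = flag_proj H n (basis_elt Xs)"

text \<open>The linear extension of the formula for the differential to combinations of flags is constant
  on the cosets of the relations; its value on a coset is the differential.\<close>

definition pre_diff ::
    "(nat \<Rightarrow> (complex ^ 'm) set) \<Rightarrow> nat \<Rightarrow> ((complex ^ 'm) set list \<Rightarrow> complex)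
      \<Rightarrow> ((complex ^ 'm) set list \<Rightarrow> complex) set"
  where "pre_diff H n c =
    (\<Oplus>\<^bsub>flag_space H n\<^esub> Xs \<in> flags H n. c Xs \<odot>\<^bsub>flag_space H n\<^esub>
      (\<Oplus>\<^bsub>flag_space H n\<^esub> X \<in> {X \<in> lat H n. last Xs \<prec> X \<and> codim X = codim (last Xs) + 1}.
        flag_class H n (Xs @ [X])))"

definition flag_diff ::
    "(nat \<Rightarrow> (complex ^ 'm) set) \<Rightarrow> nat \<Rightarrow> ((complex ^ 'm) set list \<Rightarrow> complex) set
      \<Rightarrow> ((complex ^ 'm) set list \<Rightarrow> complex) set"
  where "flag_diff H n A = the_elem (pre_diff H n ` A)"

definition im_diff ::
    "(nat \<Rightarrow> (complex ^ 'm) set) \<Rightarrow> nat \<Rightarrow> ((complex ^ 'm) set list \<Rightarrow> complex) set set"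
  where "im_diff H n = flag_diff H n ` carrier (flag_space H n)"

definition reduced_flag_space ::
    "(nat \<Rightarrow> (complex ^ 'm) set) \<Rightarrow> nat
      \<Rightarrow> (complex, ((complex ^ 'm) set list \<Rightarrow> complex) set set) module"
  where "reduced_flag_space H n = quot_module (flag_space H n) (im_diff H n)"

definition red_proj ::
    "(nat \<Rightarrow> (complex ^ 'm) set) \<Rightarrow> nat \<Rightarrow> ((complex ^ 'm) set list \<Rightarrow> complex) set
      \<Rightarrow> ((complex ^ 'm) set list \<Rightarrow> complex) set set"
  where "red_proj H n F = im_diff H n +>\<^bsub>flag_space H n\<^esub> F"


subsection \<open>Dehomogenization and transition maps\<close>

definition flag_comp ::
    "(nat \<Rightarrow> (complex ^ 'm) set) \<Rightarrow> nat \<Rightarrow> nat \<Rightarrow> (complex ^ 'm) set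
      \<Rightarrow> ((complex ^ 'm) set list \<Rightarrow> complex) set set"
  where "flag_comp H n p X =
    flag_proj H n ` span_of (flag_chains H n) {basis_elt Xs | Xs. is_flag H n p Xs \<and> last Xs = X}"

text \<open>The internal sum of the components; it is direct because the relations never change the last
  entry of a flag.\<close>

definition dehom_space ::
    "(nat \<Rightarrow> (complex ^ 'm) set) \<Rightarrow> nat \<Rightarrow> nat \<Rightarrow> nat
      \<Rightarrow> ((complex ^ 'm) set list \<Rightarrow> complex) set set"
  where "dehom_space H n p k =
    (let S = {X \<in> lat H n. codim X = p \<and> \<not> H k \<preceq> X}
     in {\<Oplus>\<^bsub>flag_space H n\<^esub> X \<in> S. g X | g. g \<in> (\<Pi> X\<in>S. flag_comp H n p X)})"

definition transition ::
    "(nat \<Rightarrow> (complex ^ 'm) set) \<Rightarrow> nat \<Rightarrow> nat \<Rightarrow> nat \<Rightarrow> nat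
      \<Rightarrow> ((complex ^ 'm) set list \<Rightarrow> complex) set \<Rightarrow> ((complex ^ 'm) set list \<Rightarrow> complex) set"
  where "transition H n p i j =
    (\<lambda>F \<in> dehom_space H n p i.
      THE G. G \<in> dehom_space H n p j \<and> red_proj H n G = red_proj H n F)"

end

theory Submission
  imports Defs "HOL-Library.Function_Algebras"
begin

text \<open>
  Both parts exhibit an element of \<open>F\<^sub>(\<^sub>j\<^sub>)\<close> that is congruent to the given flag modulo the image of
  the differential \<open>d\<close>: the flag itself in (a), and its difference with \<open>d[X\<^sub>0 < \<dots> < X\<^bsub>p-1\<^esub>]\<close>
  in (b), where \<open>X\<^sub>p = X\<^bsub>p-1\<^esub> \<inter> H\<^sub>j\<close> is the only element of codimension \<open>p\<close> above \<open>X\<^bsub>p-1\<^esub>\<close> and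
  \<open>H\<^sub>j\<close>. What remains is the injectivity of the projection \<open>\<pi>\<close> on \<open>F\<^sub>(\<^sub>j\<^sub>)\<close>. There is a linear map
  \<open>h\<close> of degree \<open>-1\<close> on the flag space with \<open>h d G = G\<close> for \<open>G\<close> in \<open>F\<^sub>(\<^sub>j\<^sub>)\<close>, so if moreover
  \<open>G = d F\<close>, then \<open>G = h d d F = 0\<close>.

  Let \<open>A\<^sub>0 < \<dots> < A\<^sub>r < C\<^sub>0 < \<dots> < C\<^sub>q\<close> be a flag in which exactly the \<open>C\<^sub>s\<close> are contained in \<open>H\<^sub>j\<close>,
  so that \<open>C\<^sub>0 = A\<^sub>r \<inter> H\<^sub>j\<close>. Up to a sign, \<open>h\<close> maps it to the sum of all flags
  \<open>A\<^sub>0 < \<dots> < A\<^sub>r < Y\<^sub>1 < \<dots> < Y\<^sub>q\<close> with \<open>Y\<^sub>s \<inter> H\<^sub>j = C\<^sub>s\<close> and no \<open>Y\<^sub>s\<close> contained in \<open>H\<^sub>j\<close>. Exchanging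
  \<open>C\<^sub>s\<close> with \<open>s \<ge> 1\<close> amounts to exchanging \<open>Y\<^sub>s\<close>, and the relations exchanging \<open>C\<^sub>0\<close> or \<open>A\<^sub>r\<close> are
  respected because of the sign \<open>(-1)\<^sup>q\<close>.
\<close>

subsection \<open>Free modules as function spaces\<close>

definition fun_scale :: "complex \<Rightarrow> ('a \<Rightarrow> complex) \<Rightarrow> 'a \<Rightarrow> complex" (infixr \<open>*\<^sub>f\<close> 75)
  where "c *\<^sub>f f = (\<lambda>x. c * f x)"

lemma fun_scale_apply [simp]: "(c *\<^sub>f f) x = c * f x"
  by (simp add: fun_scale_def)

global_interpretation fun_space: vector_space fun_scale
  by unfold_locales (simp_all add: fun_eq_iff algebra_simps)

global_interpretation fun_space_pair: vector_space_pair fun_scale fun_scale ..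

abbreviation fun_linear :: "(('a \<Rightarrow> complex) \<Rightarrow> 'b \<Rightarrow> complex) \<Rightarrow> bool"
  where "fun_linear \<equiv> Vector_Spaces.linear fun_scale fun_scale"

lemma sum_fun_apply: "(\<Sum>k\<in>K. f k) x = (\<Sum>k\<in>K. f k x)"
  by (induction K rule: infinite_finite_induct) simp_all

lemma free_module_simps [simp]:
  "f \<oplus>\<^bsub>free_module B\<^esub> g = f + g"
  "\<zero>\<^bsub>free_module B\<^esub> = 0"
  "c \<odot>\<^bsub>free_module B\<^esub> f = c *\<^sub>f f"
  by (auto simp: free_module_def fun_eq_iff)

lemma carrier_CC [simp]: "carrier CC = UNIV"
  by (simp add: CC_def)

lemma fun_sum_basis_elt:
  assumes "finite B" "{x. f x \<noteq> 0} \<subseteq> B"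
  shows "(\<Sum>b\<in>B. f b *\<^sub>f basis_elt b) = f"
proof
  fix x
  have "(\<Sum>b\<in>B. f b * basis_elt b x) = (\<Sum>b\<in>B. if x = b then f b else 0)"
    by (intro sum.cong) (simp_all add: basis_elt_def)
  then show "(\<Sum>b\<in>B. f b *\<^sub>f basis_elt b) x = f x"
    using assms by (auto simp: sum_fun_apply)
qed

lemma subspace_carrier_free_module: "fun_space.subspace (carrier (free_module B))"
proof -
  interpret Module.module CC "free_module B" by (rule module_free_module)
  show ?thesis
    using M.zero_closed M.a_closed smult_closed by (intro fun_space.subspaceI) simp_all
qed

lemmas free_module_uminus_closed [simp] = fun_space.subspace_neg[OF subspace_carrier_free_module]
  and free_module_diff_closed [simp] = fun_space.subspace_diff[OF subspace_carrier_free_module]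
  and free_module_scale_closed [simp] = fun_space.subspace_scale[OF subspace_carrier_free_module]
  and free_module_sum_closed = fun_space.subspace_sum[OF subspace_carrier_free_module]

lemma basis_elt_in_carrier [simp]: "b \<in> B \<Longrightarrow> basis_elt b \<in> carrier (free_module B)"
  by (auto simp: free_module_def basis_elt_def)

lemma carrier_free_module: "carrier (free_module B) = fun_space.span (basis_elt ` B)"
proof
  show "fun_space.span (basis_elt ` B) \<subseteq> carrier (free_module B)"
    by (intro fun_space.span_minimal subspace_carrier_free_module) auto
  show "carrier (free_module B) \<subseteq> fun_space.span (basis_elt ` B)"
  proof
    fix f assume "f \<in> carrier (free_module B)"
    then have fin: "finite {x. f x \<noteq> 0}" and support: "{x. f x \<noteq> 0} \<subseteq> B"
      by (simp_all add: free_module_def)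
    have "(\<Sum>b | f b \<noteq> 0. f b *\<^sub>f basis_elt b) \<in> fun_space.span (basis_elt ` B)"
      using support by (intro fun_space.span_sum fun_space.span_scale fun_space.span_base) auto
    then show "f \<in> fun_space.span (basis_elt ` B)"
      using fun_sum_basis_elt[OF fin] by simp
  qed
qed

lemma carrier_free_module_mono: "A \<subseteq> B \<Longrightarrow> carrier (free_module A) \<subseteq> carrier (free_module B)"
  by (auto simp: free_module_def)

lemma a_inv_free_module:
  assumes "f \<in> carrier (free_module B)"
  shows "\<ominus>\<^bsub>free_module B\<^esub> f = - f"
proof -
  interpret Module.module CC "free_module B" by (rule module_free_module)
  show ?thesis using assms by (intro M.minus_equality) simp_all
qed

lemma a_minus_free_module:
  assumes "g \<in> carrier (free_module B)"
  shows "f \<ominus>\<^bsub>free_module B\<^esub> g = f - g"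
  using assms by (simp add: a_minus_def a_inv_free_module)

lemma finsum_free_module:
  assumes "finite K" "\<And>k. k \<in> K \<Longrightarrow> f k \<in> carrier (free_module B)"
  shows "(\<Oplus>\<^bsub>free_module B\<^esub> k\<in>K. f k) = (\<Sum>k\<in>K. f k)"
proof -
  interpret Module.module CC "free_module B" by (rule module_free_module)
  show ?thesis using assms by (induction K) (simp_all add: Pi_def)
qed

lemma subspace_imp_submodule_free_module:
  assumes N: "fun_space.subspace N" and subset: "N \<subseteq> carrier (free_module B)"
  shows "submodule N CC (free_module B)"
proof -
  interpret Module.module CC "free_module B" by (rule module_free_module)
  show ?thesis
  proof (rule submoduleI)
    fix f assume "f \<in> N"
    then show "\<ominus>\<^bsub>free_module B\<^esub> f \<in> N"
      using subset fun_space.subspace_neg[OF N] by (metis a_inv_free_module subsetD)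
  qed (simp_all add: subset fun_space.subspace_0 fun_space.subspace_add fun_space.subspace_scale N)
qed

lemma span_of_free_module:
  assumes S: "S \<subseteq> carrier (free_module B)"
  shows "span_of (free_module B) S = fun_space.span S"
proof
  have "submodule (fun_space.span S) CC (free_module B)"
    by (intro subspace_imp_submodule_free_module fun_space.subspace_span fun_space.span_minimal S
        subspace_carrier_free_module)
  then show "span_of (free_module B) S \<subseteq> fun_space.span S"
    using fun_space.span_superset unfolding span_of_def by (intro Inter_lower) simp
next
  show "fun_space.span S \<subseteq> span_of (free_module B) S"
    unfolding span_of_def
  proof (rule Inter_greatest)
    fix N assume "N \<in> {N. submodule N CC (free_module B) \<and> S \<subseteq> N}"
    then have S_subset: "S \<subseteq> N" and "submodule N CC (free_module B)" by auto
    interpret submodule N CC "free_module B" by fact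
    show "fun_space.span S \<subseteq> N"
      using one_closed m_closed smult_closed
      by (intro fun_space.span_minimal[OF S_subset] fun_space.subspaceI) simp_all
  qed
qed

lemma carrier_free_module_UN:
  assumes "finite I"
  shows "carrier (free_module (\<Union>i\<in>I. A i)) =
    {\<Sum>i\<in>I. f i | f. f \<in> (\<Pi> i\<in>I. carrier (free_module (A i)))}"
    (is "_ = ?sums")
proof
  show "?sums \<subseteq> carrier (free_module (\<Union>i\<in>I. A i))"
    using carrier_free_module_mono[of "A _" "\<Union>i\<in>I. A i"]
    by (auto intro!: free_module_sum_closed)
  show "carrier (free_module (\<Union>i\<in>I. A i)) \<subseteq> ?sums"
  proof
    fix f assume "f \<in> carrier (free_module (\<Union>i\<in>I. A i))"
    then have fin: "finite {x. f x \<noteq> 0}" and "\<forall>x. \<exists>i. f x \<noteq> 0 \<longrightarrow> i \<in> I \<and> x \<in> A i"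
      by (auto simp: free_module_def)
    from choice[OF this(2)] obtain part
      where part: "\<And>x. f x \<noteq> 0 \<Longrightarrow> part x \<in> I \<and> x \<in> A (part x)" by blast
    define g where "g i x = (if part x = i then f x else 0)" for i x
    have "g \<in> (\<Pi> i\<in>I. carrier (free_module (A i)))"
      using part by (force simp: g_def free_module_def intro: finite_subset[OF _ fin])
    moreover have "f = (\<Sum>i\<in>I. g i)"
      using part assms by (auto simp: fun_eq_iff sum_fun_apply g_def)
    ultimately show "f \<in> ?sums" by blast
  qed
qed

definition linear_extension :: "'a set \<Rightarrow> ('a \<Rightarrow> 'b \<Rightarrow> complex) \<Rightarrow> ('a \<Rightarrow> complex) \<Rightarrow> 'b \<Rightarrow> complex"
  where "linear_extension B T f = (\<Sum>b\<in>B. f b *\<^sub>f T b)"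

lemma linear_linear_extension: "fun_linear (linear_extension B T)"
  unfolding Vector_Spaces.linear_iff linear_extension_def
  by (simp add: fun_space.vector_space_axioms fun_space.scale_left_distrib sum.distrib
      fun_space.scale_sum_right)

lemma linear_extension_basis_elt:
  assumes "finite B" "b \<in> B"
  shows "linear_extension B T (basis_elt b) = T b"
proof -
  have "linear_extension B T (basis_elt b) = (\<Sum>a\<in>B. if a = b then T a else 0)"
    unfolding linear_extension_def by (intro sum.cong) (auto simp: basis_elt_def fun_eq_iff)
  then show ?thesis using assms by simp
qed

lemma linear_image_span_subset:
  assumes "fun_linear T" "T ` S \<subseteq> fun_space.span R" "f \<in> fun_space.span S"
  shows "T f \<in> fun_space.span R"
proof -
  interpret T: Vector_Spaces.linear fun_scale fun_scale T by fact
  have "fun_space.span (T ` S) \<subseteq> fun_space.span R"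
    using assms(2) by (intro fun_space.span_minimal fun_space.subspace_span)
  then show ?thesis using assms(3) by (auto simp: T.span_image)
qed

subsection \<open>Quotient modules\<close>

locale submodule_quotient =
  fixes M :: "(complex, 'a) module" and N :: "'a set"
  assumes module: "Module.module CC M" and submodule: "submodule N CC M"
begin

sublocale M: Module.module CC M by (rule module)

sublocale N: submodule N CC M by (rule submodule)

sublocale N: abelian_subgroup N M
  by (rule abelian_subgroupI3)
    (auto intro: additive_subgroup.intro N.subgroup_axioms M.abelian_group_axioms)

sublocale Q: Module.module CC "quot_module M N"
  by (rule module_quot_module[OF module submodule])

lemma carrier_quot_module: "carrier (quot_module M N) = (\<lambda>a. N +>\<^bsub>M\<^esub> a) ` carrier M"
  by (auto simp: quot_module_def A_RCOSETS_def')

sublocale coset: abelian_group_hom M "quot_module M N" "\<lambda>a. N +>\<^bsub>M\<^esub> a"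
proof (intro abelian_group_homI group_hom.intro group_hom_axioms.intro homI
    M.abelian_group_axioms Q.abelian_group_axioms M.a_group Q.a_group)
  fix a b assume "a \<in> carrier (add_monoid M)" "b \<in> carrier (add_monoid M)"
  then show "N +>\<^bsub>M\<^esub> (a \<otimes>\<^bsub>add_monoid M\<^esub> b) =
      (N +>\<^bsub>M\<^esub> a) \<otimes>\<^bsub>add_monoid (quot_module M N)\<^esub> (N +>\<^bsub>M\<^esub> b)"
    by (simp add: quot_module_def N.a_rcos_sum)
qed (auto simp: carrier_quot_module)

lemma coset_eq_iff:
  assumes "a \<in> carrier M" "b \<in> carrier M"
  shows "N +>\<^bsub>M\<^esub> a = N +>\<^bsub>M\<^esub> b \<longleftrightarrow> a \<ominus>\<^bsub>M\<^esub> b \<in> N"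
proof -
  have "N +>\<^bsub>M\<^esub> a = N +>\<^bsub>M\<^esub> b \<longleftrightarrow> a \<in> N +>\<^bsub>M\<^esub> b"
    using N.a_repr_independence'[of a b] N.a_repr_independenceD[of a b] assms by metis
  also have "\<dots> \<longleftrightarrow> a \<ominus>\<^bsub>M\<^esub> b \<in> N"
    using N.a_rcos_module[of b a] assms by (simp only: a_minus_def)
  finally show ?thesis .
qed

text \<open>The scalar multiple of a coset is a coset because \<open>quot_module M N\<close> is a module, so it is
  determined by any one of its elements.\<close>

lemma smult_coset:
  assumes a: "a \<in> carrier M"
  shows "c \<odot>\<^bsub>quot_module M N\<^esub> (N +>\<^bsub>M\<^esub> a) = N +>\<^bsub>M\<^esub> (c \<odot>\<^bsub>M\<^esub> a)"
proof -
  have ca: "c \<odot>\<^bsub>M\<^esub> a \<in> carrier M" using a by (intro M.smult_closed) auto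
  have "c \<odot>\<^bsub>quot_module M N\<^esub> (N +>\<^bsub>M\<^esub> a) \<in> carrier (quot_module M N)"
    using a by (intro Q.smult_closed) auto
  then obtain b where b: "b \<in> carrier M" "c \<odot>\<^bsub>quot_module M N\<^esub> (N +>\<^bsub>M\<^esub> a) = N +>\<^bsub>M\<^esub> b"
    by (auto simp: carrier_quot_module)
  have "c \<odot>\<^bsub>M\<^esub> a \<in> c \<odot>\<^bsub>quot_module M N\<^esub> (N +>\<^bsub>M\<^esub> a)"
    using N.a_rcos_self[OF a] N.a_rcos_self[OF ca] by (auto simp: quot_module_def)
  then show ?thesis
    using M.a_repr_independence[OF _ b(1) N.a_subgroup] b(2) by simp
qed

lemma finsum_coset:
  assumes "finite K" "f \<in> K \<rightarrow> carrier M"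
  shows "(\<Oplus>\<^bsub>quot_module M N\<^esub> k\<in>K. N +>\<^bsub>M\<^esub> f k) = N +>\<^bsub>M\<^esub> (\<Oplus>\<^bsub>M\<^esub> k\<in>K. f k)"
  using assms by (induction K) (auto simp: Pi_def)

lemma submodule_coset_image:
  assumes "submodule S CC M"
  shows "submodule ((\<lambda>a. N +>\<^bsub>M\<^esub> a) ` S) CC (quot_module M N)"
proof -
  interpret S: submodule S CC M by fact
  show ?thesis
  proof (rule Q.submoduleI)
    show "(\<lambda>a. N +>\<^bsub>M\<^esub> a) ` S \<subseteq> carrier (quot_module M N)"
      using S.subset by auto
    show "\<zero>\<^bsub>quot_module M N\<^esub> \<in> (\<lambda>a. N +>\<^bsub>M\<^esub> a) ` S"
      using coset.hom_zero S.one_closed by (intro image_eqI[of _ _ "\<zero>\<^bsub>M\<^esub>"]) simp_all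
    fix A assume "A \<in> (\<lambda>a. N +>\<^bsub>M\<^esub> a) ` S"
    then obtain a where A: "A = N +>\<^bsub>M\<^esub> a" and a: "a \<in> S" "a \<in> carrier M" using S.subset by auto
    show "\<ominus>\<^bsub>quot_module M N\<^esub> A \<in> (\<lambda>a. N +>\<^bsub>M\<^esub> a) ` S"
      unfolding A using coset.hom_a_inv[OF a(2)] M.submoduleE(3)[OF assms a(1)]
      by (intro image_eqI[of _ _ "\<ominus>\<^bsub>M\<^esub> a"]) simp_all
    show "c \<odot>\<^bsub>quot_module M N\<^esub> A \<in> (\<lambda>a. N +>\<^bsub>M\<^esub> a) ` S" if "c \<in> carrier CC" for c
      unfolding A smult_coset[OF a(2)] using that a(1) by (intro imageI S.smult_closed)
    fix B assume "B \<in> (\<lambda>a. N +>\<^bsub>M\<^esub> a) ` S"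
    then obtain b where B: "B = N +>\<^bsub>M\<^esub> b" and b: "b \<in> S" "b \<in> carrier M" using S.subset by auto
    show "A \<oplus>\<^bsub>quot_module M N\<^esub> B \<in> (\<lambda>a. N +>\<^bsub>M\<^esub> a) ` S"
      unfolding A B using coset.hom_add[OF a(2) b(2)] M.submoduleE(5)[OF assms a(1) b(1)]
      by (intro image_eqI[of _ _ "a \<oplus>\<^bsub>M\<^esub> b"]) simp_all
  qed
qed

end

subsection \<open>Flags of an arrangement\<close>

locale arrangement =
  fixes H :: "nat \<Rightarrow> (complex ^ 'm) set" and n :: nat
  assumes arrangement: "central_arrangement H n"
begin

definition covered_by :: "(complex ^ 'm) set \<Rightarrow> (complex ^ 'm) set \<Rightarrow> bool"
    (infix \<open>\<prec>\<cdot>\<close> 50)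
  where "X \<prec>\<cdot> Y \<longleftrightarrow> X \<in> lat H n \<and> Y \<in> lat H n \<and> X \<prec> Y \<and> codim Y = codim X + 1"

lemma covered_by_iff:
  "X \<prec>\<cdot> Y \<longleftrightarrow> X \<in> lat H n \<and> Y \<in> lat H n \<and> Y \<subseteq> X \<and> codim Y = codim X + 1"
  by (auto simp: covered_by_def lat_less_def lat_le_def)

lemma covered_by_subset: "X \<prec>\<cdot> Y \<Longrightarrow> Y \<subseteq> X"
  by (simp add: covered_by_iff)

lemma finite_lat: "finite (lat H n)"
proof -
  have "lat H n = (\<lambda>S. \<Inter>k\<in>S. H k) ` Pow {..n}" by (auto simp: lat_def)
  then show ?thesis by simp
qed

lemma finite_covered_by [simp]:
  "finite {Y. X \<prec>\<cdot> Y \<and> P Y}" "finite {Y. X \<prec>\<cdot> Y}"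
  by (rule finite_subset[OF _ finite_lat]; auto simp: covered_by_iff)+

lemma lat_subspace: "X \<in> lat H n \<Longrightarrow> vec.subspace X"
  using arrangement
  by (auto simp: lat_def central_arrangement_def linear_hyperplane_def intro!: vec.subspace_Inter)

lemma lat_Int_hyperplane:
  assumes "X \<in> lat H n" "k \<le> n"
  shows "X \<inter> H k \<in> lat H n"
proof -
  obtain S where "S \<subseteq> {..n}" "X = (\<Inter>k\<in>S. H k)" using assms by (auto simp: lat_def)
  then have "X \<inter> H k = (\<Inter>k\<in>insert k S. H k)" "insert k S \<subseteq> {..n}" using assms by auto
  then show ?thesis unfolding lat_def by blast
qed

lemma dim_hyperplane: "k \<le> n \<Longrightarrow> vec.dim (H k) + 1 = CARD('m)"
  using arrangement by (simp add: central_arrangement_def linear_hyperplane_def)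

lemma codim_add_dim: "codim X + vec.dim X = CARD('m)" for X :: "(complex ^ 'm) set"
  using dim_subset_UNIV_cart_gen[of X] by (simp add: codim_def)

lemma lat_eqI:
  assumes "X \<in> lat H n" "Y \<in> lat H n" "X \<subseteq> Y" "codim X = codim Y"
  shows "X = Y"
  using codim_add_dim[of X] codim_add_dim[of Y] assms
  by (intro vec.subspace_dim_equal) (auto simp: lat_subspace)

lemma codim_0_not_subset_hyperplane:
  assumes "codim X = 0" "k \<le> n"
  shows "\<not> X \<subseteq> H k"
  using vec.dim_subset[of X "H k"] dim_hyperplane[OF assms(2)] codim_add_dim[of X] assms(1) by auto

lemma covered_by_Int_hyperplane:
  assumes X: "X \<in> lat H n" and k: "k \<le> n" and not_subset: "\<not> X \<subseteq> H k"
  shows "X \<prec>\<cdot> X \<inter> H k"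
proof -
  have XH: "X \<inter> H k \<in> lat H n" using X k by (rule lat_Int_hyperplane)
  have "vec.subspace (H k)"
    using arrangement k by (simp add: central_arrangement_def linear_hyperplane_def)
  then have "vec.dim {x + y | x y. x \<in> X \<and> y \<in> H k} + vec.dim (X \<inter> H k) =
      vec.dim X + vec.dim (H k)"
    using lat_subspace[OF X] by (intro vec.dim_sums_Int)
  moreover have "vec.dim {x + y | x y. x \<in> X \<and> y \<in> H k} \<le> CARD('m)"
    by (rule dim_subset_UNIV_cart_gen)
  ultimately have "vec.dim X \<le> vec.dim (X \<inter> H k) + 1" using dim_hyperplane[OF k] by linarith
  moreover have "\<not> vec.dim X \<le> vec.dim (X \<inter> H k)"
    using vec.subspace_dim_equal[OF lat_subspace[OF XH] lat_subspace[OF X]] not_subset by blast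
  ultimately have "codim (X \<inter> H k) = codim X + 1"
    using codim_add_dim[of X] codim_add_dim[of "X \<inter> H k"] by linarith
  then show ?thesis using X XH by (simp add: covered_by_iff)
qed

lemma covered_by_eq_Int_hyperplane:
  assumes "X \<prec>\<cdot> Y" "k \<le> n" "\<not> X \<subseteq> H k" "Y \<subseteq> H k"
  shows "Y = X \<inter> H k"
proof (rule lat_eqI)
  show "codim Y = codim (X \<inter> H k)"
    using covered_by_Int_hyperplane[of X k] assms by (simp add: covered_by_iff)
qed (use assms in \<open>auto simp: covered_by_iff lat_Int_hyperplane\<close>)

lemma covered_by_Int_Int_hyperplane:
  assumes "X \<prec>\<cdot> Y" "k \<le> n" "\<not> Y \<subseteq> H k"
  shows "X \<inter> H k \<prec>\<cdot> Y \<inter> H k"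
proof -
  have "\<not> X \<subseteq> H k" using assms by (auto simp: covered_by_iff)
  then show ?thesis
    using covered_by_Int_hyperplane[of X k] covered_by_Int_hyperplane[of Y k] assms
    by (auto simp: covered_by_iff)
qed

lemma is_flag_iff: "is_flag H n p Xs \<longleftrightarrow> Xs \<in> flags H n \<and> length Xs = p + 1"
  by (auto simp: flags_def is_flag_def)

lemma flags_nonempty: "Xs \<in> flags H n \<Longrightarrow> Xs \<noteq> []"
  by (auto simp: flags_def is_flag_def)

lemma codim_flag_nth: "Xs \<in> flags H n \<Longrightarrow> r < length Xs \<Longrightarrow> codim (Xs ! r) = r"
  by (auto simp: flags_def is_flag_def)

lemma codim_last_flag: "Xs \<in> flags H n \<Longrightarrow> codim (last Xs) = length Xs - 1"
  using codim_flag_nth[of Xs "length Xs - 1"] flags_nonempty[of Xs] by (simp add: last_conv_nth)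

lemma set_flag_subset_lat: "Xs \<in> flags H n \<Longrightarrow> set Xs \<subseteq> lat H n"
  by (auto simp: flags_def is_flag_def)

lemma last_flag_in_lat: "Xs \<in> flags H n \<Longrightarrow> last Xs \<in> lat H n"
  using set_flag_subset_lat flags_nonempty last_in_set by blast

lemma finite_flags: "finite (flags H n)"
proof (rule finite_subset)
  show "flags H n \<subseteq> {Xs. set Xs \<subseteq> lat H n \<and> length Xs \<le> CARD('m) + 1}"
  proof
    fix Xs assume Xs: "Xs \<in> flags H n"
    then have "length Xs - 1 \<le> CARD('m)"
      using codim_last_flag codim_add_dim[of "last Xs"] by fastforce
    then show "Xs \<in> {Xs. set Xs \<subseteq> lat H n \<and> length Xs \<le> CARD('m) + 1}"
      using set_flag_subset_lat[OF Xs] by simp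
  qed
  show "finite {Xs. set Xs \<subseteq> lat H n \<and> length Xs \<le> CARD('m) + 1}"
    by (rule finite_lists_length_le[OF finite_lat])
qed

lemma flags_imp_successively:
  assumes Xs: "Xs \<in> flags H n"
  shows "successively (\<prec>\<cdot>) Xs"
proof -
  have "sorted_wrt (\<prec>) Xs" using Xs by (auto simp: flags_def is_flag_def)
  then have "successively (\<prec>) Xs" by (rule successively_if_sorted_wrt)
  then show ?thesis
    using codim_flag_nth[OF Xs] set_flag_subset_lat[OF Xs]
    by (auto simp: successively_conv_nth covered_by_def subset_iff)
qed

lemma successively_imp_flags:
  assumes nonempty: "Xs \<noteq> []" and hd: "hd Xs \<in> lat H n" "codim (hd Xs) = 0"
    and succ: "successively (\<prec>\<cdot>) Xs"
  shows "Xs \<in> flags H n"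
proof -
  have nth: "Xs ! r \<in> lat H n \<and> codim (Xs ! r) = r" if "r < length Xs" for r
    using that
  proof (induction r)
    case 0
    then show ?case using hd by (simp add: hd_conv_nth)
  next
    case (Suc r)
    then show ?case using succ by (simp add: successively_conv_nth covered_by_iff)
  qed
  have "successively (\<prec>) Xs"
    using succ by (rule successively_mono) (simp add: covered_by_def)
  then have "sorted_wrt (\<prec>) Xs"
    by (subst (asm) successively_conv_sorted_wrt)
      (auto simp: lat_less_def lat_le_def transp_def)
  moreover have "set Xs \<subseteq> lat H n" using nth by (auto simp: in_set_conv_nth)
  moreover obtain p where "length Xs = p + 1" using nonempty by (cases Xs) auto
  ultimately have "is_flag H n p Xs" using nth by (simp add: is_flag_def)
  then show ?thesis by (auto simp: flags_def)
qed

lemma flags_iff: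
  "Xs \<in> flags H n \<longleftrightarrow> Xs \<noteq> [] \<and> hd Xs \<in> lat H n \<and> codim (hd Xs) = 0 \<and> successively (\<prec>\<cdot>) Xs"
  using flags_nonempty[of Xs] set_flag_subset_lat[of Xs] codim_flag_nth[of Xs 0]
    flags_imp_successively[of Xs] successively_imp_flags[of Xs]
  by (cases Xs) auto

lemma flags_append_iff:
  assumes "As \<noteq> []" "Bs \<noteq> []"
  shows "As @ Bs \<in> flags H n \<longleftrightarrow>
    As \<in> flags H n \<and> last As \<prec>\<cdot> hd Bs \<and> successively (\<prec>\<cdot>) Bs"
  using assms by (auto simp: flags_iff successively_append_iff)

lemma flags_snoc_iff:
  "As \<noteq> [] \<Longrightarrow> As @ [X] \<in> flags H n \<longleftrightarrow> As \<in> flags H n \<and> last As \<prec>\<cdot> X"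
  by (simp add: flags_append_iff)

lemma flags_insert_iff:
  assumes "As \<noteq> []" "Bs \<noteq> []"
  shows "As @ Y # Bs \<in> flags H n \<longleftrightarrow>
    As \<in> flags H n \<and> last As \<prec>\<cdot> Y \<and> Y \<prec>\<cdot> hd Bs \<and> successively (\<prec>\<cdot>) Bs"
  using assms by (auto simp: flags_append_iff successively_Cons)

lemma last_flag_subset:
  assumes Xs: "Xs \<in> flags H n" and X: "X \<in> set Xs"
  shows "last Xs \<subseteq> X"
proof -
  obtain As Bs where split: "Xs = As @ X # Bs" using X by (auto simp: in_set_conv_decomp)
  have "sorted_wrt (\<prec>) Xs" using Xs by (auto simp: flags_def is_flag_def)
  then have "\<forall>B\<in>set Bs. X \<prec> B" using split by (simp add: sorted_wrt_append)
  then show ?thesis using split by (cases Bs rule: rev_cases) (auto simp: lat_less_def lat_le_def)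
qed

subsection \<open>The flag space and its differential\<close>

abbreviation chains :: "((complex ^ 'm) set list \<Rightarrow> complex) set"
  where "chains \<equiv> carrier (flag_chains H n)"

definition flag_relation ::
    "(complex ^ 'm) set list \<Rightarrow> (complex ^ 'm) set list \<Rightarrow> (complex ^ 'm) set list \<Rightarrow> complex"
  where "flag_relation As Bs = (\<Sum>Y | As @ Y # Bs \<in> flags H n. basis_elt (As @ Y # Bs))"

lemma finite_flag_insertions [simp]: "finite {Y. As @ Y # Bs \<in> flags H n}"
  by (rule finite_subset[OF _ finite_lat]) (auto dest: set_flag_subset_lat)

lemma finsum_flag_relation:
  assumes flag: "As @ Z # Bs \<in> flags H n" and nonempty: "As \<noteq> []" "Bs \<noteq> []"
  defines "Xs \<equiv> As @ Z # Bs" and "r \<equiv> length As"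
  shows "(\<Oplus>\<^bsub>flag_chains H n\<^esub>
      Y \<in> {Y \<in> lat H n. Xs ! (r - 1) \<prec> Y \<and> Y \<prec> Xs ! (r + 1) \<and> codim Y = r}.
        basis_elt (Xs[r := Y])) = flag_relation As Bs"
proof -
  have As: "As \<in> flags H n" and Z: "last As \<prec>\<cdot> Z" "Z \<prec>\<cdot> hd Bs"
    and Bs: "successively (\<prec>\<cdot>) Bs"
    using flag nonempty by (simp_all add: flags_insert_iff)
  have nth: "Xs ! (r - 1) = last As" "Xs ! (r + 1) = hd Bs"
    using nonempty by (simp_all add: Xs_def r_def nth_append last_conv_nth hd_conv_nth)
  have "codim (last As) + 1 = r" using codim_last_flag[OF As] nonempty by (simp add: r_def)
  then have "Y \<in> lat H n \<and> last As \<prec> Y \<and> Y \<prec> hd Bs \<and> codim Y = r \<longleftrightarrow> As @ Y # Bs \<in> flags H n"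
    for Y
    using Z As Bs nonempty by (auto simp: flags_insert_iff covered_by_def)
  then have "{Y \<in> lat H n. Xs ! (r - 1) \<prec> Y \<and> Y \<prec> Xs ! (r + 1) \<and> codim Y = r} =
      {Y. As @ Y # Bs \<in> flags H n}"
    unfolding nth by blast
  moreover have "Xs[r := Y] = As @ Y # Bs" for Y by (simp add: Xs_def r_def)
  ultimately show ?thesis
    unfolding flag_relation_def by (auto intro!: finsum_free_module)
qed

lemma flag_relations_eq:
  "flag_relations H n = {flag_relation As Bs | As Bs.
    As \<noteq> [] \<and> Bs \<noteq> [] \<and> (\<exists>Y. As @ Y # Bs \<in> flags H n)}" (is "_ = ?R")
proof (intro equalityI subsetI)
  fix c assume "c \<in> flag_relations H n"
  then obtain Xs p r where c_eq: "c = (\<Oplus>\<^bsub>flag_chains H n\<^esub>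
      Y \<in> {Y \<in> lat H n. Xs ! (r - 1) \<prec> Y \<and> Y \<prec> Xs ! (r + 1) \<and> codim Y = r}.
        basis_elt (Xs[r := Y]))"
    and Xs: "is_flag H n p Xs" and r: "0 < r" "r < p"
    unfolding flag_relations_def by blast
  let ?As = "take r Xs" and ?Bs = "drop (Suc r) Xs"
  have len: "length Xs = p + 1" and "Xs \<in> flags H n" using Xs by (simp_all add: is_flag_iff)
  moreover have split: "Xs = ?As @ Xs ! r # ?Bs" using len r by (intro id_take_nth_drop) simp
  ultimately have flag: "?As @ Xs ! r # ?Bs \<in> flags H n" by simp
  have nonempty: "?As \<noteq> []" "?Bs \<noteq> []" and len_take: "length ?As = r" using len r by auto
  have "c = flag_relation ?As ?Bs"
    unfolding c_eq using finsum_flag_relation[OF flag nonempty]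
    unfolding split[symmetric] len_take .
  then show "c \<in> ?R" using nonempty flag by blast
next
  fix c assume "c \<in> ?R"
  then obtain As Bs Y where c_eq: "c = flag_relation As Bs"
    and nonempty: "As \<noteq> []" "Bs \<noteq> []" and flag: "As @ Y # Bs \<in> flags H n" by blast
  have "is_flag H n (length As + length Bs) (As @ Y # Bs) \<and> 0 < length As
      \<and> length As < length As + length Bs"
    using flag nonempty by (simp add: is_flag_iff)
  then show "c \<in> flag_relations H n"
    unfolding flag_relations_def
    using finsum_flag_relation[OF flag nonempty, symmetric] c_eq by blast
qed

lemma flag_relations_subset: "flag_relations H n \<subseteq> chains"
  unfolding flag_relations_eq flag_relation_def
  by (auto intro!: free_module_sum_closed)

lemma flag_rel_span_eq: "flag_rel_span H n = fun_space.span (flag_relations H n)"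
  unfolding flag_rel_span_def by (rule span_of_free_module[OF flag_relations_subset])

lemma subspace_flag_rel_span: "fun_space.subspace (flag_rel_span H n)"
  by (simp add: flag_rel_span_eq)

lemmas zero_in_flag_rel_span = fun_space.subspace_0[OF subspace_flag_rel_span]
  and flag_rel_span_neg = fun_space.subspace_neg[OF subspace_flag_rel_span]
  and flag_rel_span_sum = fun_space.subspace_sum[OF subspace_flag_rel_span]

lemma flag_relation_in_flag_rel_span:
  assumes "As \<noteq> []" "Bs \<noteq> []"
  shows "flag_relation As Bs \<in> flag_rel_span H n"
proof (cases "\<exists>Y. As @ Y # Bs \<in> flags H n")
  case True
  then have "flag_relation As Bs \<in> flag_relations H n" using assms by (auto simp: flag_relations_eq)
  then show ?thesis unfolding flag_rel_span_eq by (rule fun_space.span_base)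
next
  case False
  then have "flag_relation As Bs = 0" by (simp add: flag_relation_def)
  then show ?thesis using zero_in_flag_rel_span by simp
qed

lemma submodule_flag_rel_span: "submodule (flag_rel_span H n) CC (flag_chains H n)"
  unfolding flag_rel_span_def
  by (rule submodule_span_of[OF module_free_module flag_relations_subset])

sublocale flag_space: submodule_quotient "flag_chains H n" "flag_rel_span H n"
  rewrites "quot_module (flag_chains H n) (flag_rel_span H n) = flag_space H n"
    and "(\<lambda>c. flag_rel_span H n +>\<^bsub>flag_chains H n\<^esub> c) = flag_proj H n"
    and "flag_rel_span H n +>\<^bsub>flag_chains H n\<^esub> c = flag_proj H n c"
  by (rule submodule_quotient.intro[OF module_free_module submodule_flag_rel_span])
    (simp_all add: flag_space_def flag_proj_def fun_eq_iff)

lemma flag_proj_add: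
  "a \<in> chains \<Longrightarrow> b \<in> chains \<Longrightarrow>
    flag_proj H n (a + b) = flag_proj H n a \<oplus>\<^bsub>flag_space H n\<^esub> flag_proj H n b"
  using flag_space.coset.hom_add[of a b] by simp

lemma flag_proj_uminus:
  "a \<in> chains \<Longrightarrow> flag_proj H n (- a) = \<ominus>\<^bsub>flag_space H n\<^esub> flag_proj H n a"
  using flag_space.coset.hom_a_inv[of a] by (simp add: a_inv_free_module)

lemma flag_proj_scale:
  "a \<in> chains \<Longrightarrow> flag_proj H n (k *\<^sub>f a) = k \<odot>\<^bsub>flag_space H n\<^esub> flag_proj H n a"
  using flag_space.smult_coset[of a k] by simp

lemma flag_proj_sum:
  assumes "finite K" "\<And>k. k \<in> K \<Longrightarrow> f k \<in> chains"
  shows "flag_proj H n (\<Sum>k\<in>K. f k) = (\<Oplus>\<^bsub>flag_space H n\<^esub> k\<in>K. flag_proj H n (f k))"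
  using flag_space.finsum_coset[of K f] finsum_free_module[of K f] assms by (simp add: Pi_def)

lemma flag_proj_eq_iff:
  "a \<in> chains \<Longrightarrow> b \<in> chains \<Longrightarrow>
    flag_proj H n a = flag_proj H n b \<longleftrightarrow> a - b \<in> flag_rel_span H n"
  using flag_space.coset_eq_iff[of a b] by (simp add: a_minus_free_module)

lemma linear_image_flag_rel_span:
  assumes linear: "fun_linear T"
    and relations: "\<And>As Bs. As \<noteq> [] \<Longrightarrow> Bs \<noteq> [] \<Longrightarrow> T (flag_relation As Bs) \<in> flag_rel_span H n"
    and "c \<in> flag_rel_span H n"
  shows "T c \<in> flag_rel_span H n"
proof -
  have "T ` flag_relations H n \<subseteq> flag_rel_span H n"
    using relations by (auto simp: flag_relations_eq)
  then show ?thesis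
    using linear_image_span_subset[OF linear] assms(3) unfolding flag_rel_span_eq by blast
qed

definition coboundary :: "(complex ^ 'm) set list \<Rightarrow> (complex ^ 'm) set list \<Rightarrow> complex"
  where "coboundary Xs = (\<Sum>X | last Xs \<prec>\<cdot> X. basis_elt (Xs @ [X]))"

definition chain_diff ::
    "((complex ^ 'm) set list \<Rightarrow> complex) \<Rightarrow> (complex ^ 'm) set list \<Rightarrow> complex"
  where "chain_diff = linear_extension (flags H n) coboundary"

lemma linear_chain_diff: "fun_linear chain_diff"
  unfolding chain_diff_def by (rule linear_linear_extension)

lemma chain_diff_basis_elt: "Xs \<in> flags H n \<Longrightarrow> chain_diff (basis_elt Xs) = coboundary Xs"
  unfolding chain_diff_def by (rule linear_extension_basis_elt[OF finite_flags])

lemma coboundary_in_chains: "Xs \<in> flags H n \<Longrightarrow> coboundary Xs \<in> chains"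
  unfolding coboundary_def
  by (auto intro!: free_module_sum_closed simp: flags_snoc_iff flags_nonempty)

lemma chain_diff_in_chains: "chain_diff c \<in> chains"
  unfolding chain_diff_def linear_extension_def
  by (intro free_module_sum_closed free_module_scale_closed coboundary_in_chains)

lemma chain_diff_flag_relation:
  assumes nonempty: "As \<noteq> []" "Bs \<noteq> []"
  shows "chain_diff (flag_relation As Bs) = (\<Sum>X | last Bs \<prec>\<cdot> X. flag_relation As (Bs @ [X]))"
proof -
  have "chain_diff (flag_relation As Bs) = (\<Sum>Y | As @ Y # Bs \<in> flags H n. coboundary (As @ Y # Bs))"
    unfolding flag_relation_def fun_space_pair.linear_sum[OF linear_chain_diff]
    by (simp add: chain_diff_basis_elt)
  also have "\<dots> = (\<Sum>X | last Bs \<prec>\<cdot> X. \<Sum>Y | As @ Y # Bs \<in> flags H n. basis_elt (As @ Y # Bs @ [X]))"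
    unfolding coboundary_def using nonempty(2) by (subst sum.swap) simp
  also have "\<dots> = (\<Sum>X | last Bs \<prec>\<cdot> X. flag_relation As (Bs @ [X]))"
    unfolding flag_relation_def using nonempty
    by (intro sum.cong refl) (auto simp: flags_insert_iff successively_append_iff)
  finally show ?thesis .
qed

lemma chain_diff_coboundary:
  assumes Xs: "Xs \<in> flags H n"
  shows "chain_diff (coboundary Xs) = (\<Sum>Z\<in>lat H n. flag_relation Xs [Z])"
proof -
  have nonempty: "Xs \<noteq> []" using Xs by (rule flags_nonempty)
  have "chain_diff (coboundary Xs) = (\<Sum>X | last Xs \<prec>\<cdot> X. coboundary (Xs @ [X]))"
    unfolding coboundary_def[of Xs] fun_space_pair.linear_sum[OF linear_chain_diff]
    using Xs nonempty by (intro sum.cong) (simp_all add: chain_diff_basis_elt flags_snoc_iff)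
  also have "\<dots> = (\<Sum>X | last Xs \<prec>\<cdot> X. \<Sum>Z | Z \<in> lat H n \<and> X \<prec>\<cdot> Z. basis_elt (Xs @ [X, Z]))"
    unfolding coboundary_def by (intro sum.cong) (auto simp: covered_by_iff)
  also have "\<dots> = (\<Sum>Z\<in>lat H n. \<Sum>X | X \<in> {X. last Xs \<prec>\<cdot> X} \<and> X \<prec>\<cdot> Z. basis_elt (Xs @ [X, Z]))"
    by (rule sum.swap_restrict) (simp_all add: finite_lat)
  also have "\<dots> = (\<Sum>Z\<in>lat H n. flag_relation Xs [Z])"
    unfolding flag_relation_def using Xs nonempty by (intro sum.cong) (auto simp: flags_insert_iff)
  finally show ?thesis .
qed

lemma chain_diff_flag_rel_span:
  assumes "c \<in> flag_rel_span H n"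
  shows "chain_diff c \<in> flag_rel_span H n"
  using linear_chain_diff _ assms
proof (rule linear_image_flag_rel_span)
  show "chain_diff (flag_relation As Bs) \<in> flag_rel_span H n" if "As \<noteq> []" "Bs \<noteq> []" for As Bs
    unfolding chain_diff_flag_relation[OF that]
    by (intro flag_rel_span_sum flag_relation_in_flag_rel_span that) simp
qed

lemma chain_diff_chain_diff:
  assumes "c \<in> chains"
  shows "chain_diff (chain_diff c) \<in> flag_rel_span H n"
  unfolding flag_rel_span_eq
proof (rule linear_image_span_subset[where T = "\<lambda>c. chain_diff (chain_diff c)"])
  show "fun_linear (\<lambda>c. chain_diff (chain_diff c))"
    using Vector_Spaces.linear_compose[OF linear_chain_diff linear_chain_diff]
    by (simp add: comp_def)
  have "chain_diff (coboundary Xs) \<in> flag_rel_span H n" if "Xs \<in> flags H n" for Xs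
    unfolding chain_diff_coboundary[OF that] using flags_nonempty[OF that]
    by (intro flag_rel_span_sum flag_relation_in_flag_rel_span) simp_all
  then show "(\<lambda>c. chain_diff (chain_diff c)) ` basis_elt ` flags H n
      \<subseteq> fun_space.span (flag_relations H n)"
    by (auto simp: chain_diff_basis_elt simp flip: flag_rel_span_eq)
qed (use assms in \<open>simp add: carrier_free_module\<close>)

lemma flag_proj_coboundary:
  assumes Xs: "Xs \<in> flags H n"
  shows "flag_proj H n (coboundary Xs) =
    (\<Oplus>\<^bsub>flag_space H n\<^esub> X \<in> {X \<in> lat H n. last Xs \<prec> X \<and> codim X = codim (last Xs) + 1}.
      flag_class H n (Xs @ [X]))"
proof -
  have "{X \<in> lat H n. last Xs \<prec> X \<and> codim X = codim (last Xs) + 1} = {X. last Xs \<prec>\<cdot> X}"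
    using last_flag_in_lat[OF Xs] by (auto simp: covered_by_def)
  then show ?thesis
    unfolding coboundary_def flag_class_def using Xs
    by (subst flag_proj_sum) (auto simp: flags_snoc_iff flags_nonempty)
qed

lemma pre_diff_eq: "pre_diff H n c = flag_proj H n (chain_diff c)"
proof -
  have chains: "c Xs *\<^sub>f coboundary Xs \<in> chains" if "Xs \<in> flags H n" for Xs
    by (intro free_module_scale_closed coboundary_in_chains that)
  have "pre_diff H n c = (\<Oplus>\<^bsub>flag_space H n\<^esub> Xs\<in>flags H n. flag_proj H n (c Xs *\<^sub>f coboundary Xs))"
    unfolding pre_diff_def
  proof (intro flag_space.Q.finsum_cong' refl Pi_I flag_space.coset.hom_closed chains)
    fix Xs assume "Xs \<in> flags H n"
    then show "c Xs \<odot>\<^bsub>flag_space H n\<^esub>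
        (\<Oplus>\<^bsub>flag_space H n\<^esub> X \<in> {X \<in> lat H n. last Xs \<prec> X \<and> codim X = codim (last Xs) + 1}.
          flag_class H n (Xs @ [X])) = flag_proj H n (c Xs *\<^sub>f coboundary Xs)"
      by (simp only: flag_proj_coboundary flag_proj_scale coboundary_in_chains)
  qed
  also have "\<dots> = flag_proj H n (chain_diff c)"
    unfolding chain_diff_def linear_extension_def
    by (rule flag_proj_sum[OF finite_flags chains, symmetric])
  finally show ?thesis .
qed

lemma flag_diff_flag_proj:
  assumes chain: "c \<in> chains"
  shows "flag_diff H n (flag_proj H n c) = flag_proj H n (chain_diff c)"
proof -
  have "pre_diff H n a = flag_proj H n (chain_diff c)" if a: "a \<in> flag_proj H n c" for a
  proof -
    have "a \<in> chains" using flag_space.N.a_elemrcos_carrier[of c a] a chain by simp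
    moreover have "a - c \<in> flag_rel_span H n"
      using flag_space.N.a_repr_independence'[of a c] a chain \<open>a \<in> chains\<close>
      by (simp flip: flag_proj_eq_iff)
    ultimately show ?thesis
      using chain_diff_flag_rel_span
      by (simp add: pre_diff_eq flag_proj_eq_iff chain_diff_in_chains
          flip: fun_space_pair.linear_diff[OF linear_chain_diff])
  qed
  moreover have "c \<in> flag_proj H n c" using flag_space.N.a_rcos_self[OF chain] by simp
  ultimately have "pre_diff H n ` flag_proj H n c = {flag_proj H n (chain_diff c)}" by blast
  then show ?thesis by (simp add: flag_diff_def)
qed

lemma im_diff_eq: "im_diff H n = flag_proj H n ` chain_diff ` chains"
  unfolding im_diff_def flag_space.carrier_quot_module image_image
  by (intro image_cong refl flag_diff_flag_proj)

lemma submodule_im_diff: "submodule (im_diff H n) CC (flag_space H n)"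
proof -
  have "fun_space.subspace (chain_diff ` chains)"
    by (intro fun_space_pair.linear_subspace_image linear_chain_diff subspace_carrier_free_module)
  then have "submodule (chain_diff ` chains) CC (flag_chains H n)"
    by (rule subspace_imp_submodule_free_module) (use chain_diff_in_chains in blast)
  then show ?thesis unfolding im_diff_eq by (rule flag_space.submodule_coset_image)
qed

sublocale reduced_flag_space: submodule_quotient "flag_space H n" "im_diff H n"
  by (rule submodule_quotient.intro[OF flag_space.Q.module_axioms submodule_im_diff])

lemma red_proj_eq_iff:
  assumes "f \<in> chains" "g \<in> chains"
  shows "red_proj H n (flag_proj H n f) = red_proj H n (flag_proj H n g) \<longleftrightarrow>
    (\<exists>c\<in>chains. f - g - chain_diff c \<in> flag_rel_span H n)"
proof -
  have "red_proj H n (flag_proj H n f) = red_proj H n (flag_proj H n g) \<longleftrightarrow>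
      flag_proj H n f \<ominus>\<^bsub>flag_space H n\<^esub> flag_proj H n g \<in> im_diff H n"
    unfolding red_proj_def using assms by (intro reduced_flag_space.coset_eq_iff) simp_all
  also have "flag_proj H n f \<ominus>\<^bsub>flag_space H n\<^esub> flag_proj H n g = flag_proj H n (f - g)"
    using assms flag_proj_add[of f "- g"]
    by (simp add: a_minus_def flag_proj_uminus)
  also have "\<dots> \<in> im_diff H n \<longleftrightarrow> (\<exists>c\<in>chains. f - g - chain_diff c \<in> flag_rel_span H n)"
    using assms
    by (auto simp: im_diff_eq image_image image_iff flag_proj_eq_iff chain_diff_in_chains)
  finally show ?thesis .
qed

lemma is_flag_subset_flags: "{Xs. is_flag H n p Xs \<and> P Xs} \<subseteq> flags H n"
  by (auto simp: is_flag_iff)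

lemma flag_comp_eq:
  "flag_comp H n p X = flag_proj H n ` carrier (free_module {Xs. is_flag H n p Xs \<and> last Xs = X})"
proof -
  let ?A = "{Xs. is_flag H n p Xs \<and> last Xs = X}"
  have "basis_elt ` ?A \<subseteq> chains" by (auto simp: is_flag_iff)
  moreover have "{basis_elt Xs | Xs. is_flag H n p Xs \<and> last Xs = X} = basis_elt ` ?A" by blast
  ultimately show ?thesis
    by (simp only: flag_comp_def span_of_free_module carrier_free_module)
qed

lemma sums_flag_proj_image:
  assumes K: "finite K" and C: "\<And>k. k \<in> K \<Longrightarrow> C k \<subseteq> chains"
  shows "{\<Oplus>\<^bsub>flag_space H n\<^esub> k\<in>K. g k | g. g \<in> (\<Pi> k\<in>K. flag_proj H n ` C k)} =
    flag_proj H n ` {\<Sum>k\<in>K. f k | f. f \<in> (\<Pi> k\<in>K. C k)}"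
    (is "?sums = flag_proj H n ` ?S")
proof (intro equalityI subsetI)
  fix F assume "F \<in> ?sums"
  then obtain g where F: "F = (\<Oplus>\<^bsub>flag_space H n\<^esub> k\<in>K. g k)"
    and "\<forall>k\<in>K. \<exists>f. f \<in> C k \<and> g k = flag_proj H n f" by blast
  from bchoice[OF this(2)] obtain f
    where f: "f \<in> (\<Pi> k\<in>K. C k)" and g: "\<And>k. k \<in> K \<Longrightarrow> g k = flag_proj H n (f k)" by blast
  have chains: "f k \<in> chains" if "k \<in> K" for k using that f C by blast
  have "F = (\<Oplus>\<^bsub>flag_space H n\<^esub> k\<in>K. flag_proj H n (f k))"
    unfolding F by (intro flag_space.Q.finsum_cong' refl Pi_I flag_space.coset.hom_closed g chains)
  also have "\<dots> = flag_proj H n (\<Sum>k\<in>K. f k)" by (rule flag_proj_sum[OF K chains, symmetric])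
  finally show "F \<in> flag_proj H n ` ?S" using f by blast
next
  fix F assume "F \<in> flag_proj H n ` ?S"
  then obtain f where f: "f \<in> (\<Pi> k\<in>K. C k)" and F: "F = flag_proj H n (\<Sum>k\<in>K. f k)" by blast
  have "F = (\<Oplus>\<^bsub>flag_space H n\<^esub> k\<in>K. flag_proj H n (f k))"
    unfolding F using f C by (intro flag_proj_sum[OF K]) blast
  moreover have "(\<lambda>k. flag_proj H n (f k)) \<in> (\<Pi> k\<in>K. flag_proj H n ` C k)" using f by blast
  ultimately show "F \<in> ?sums" by blast
qed

lemma dehom_space_eq:
  "dehom_space H n p k =
    flag_proj H n ` carrier (free_module {Xs. is_flag H n p Xs \<and> \<not> H k \<preceq> last Xs})"
proof -
  let ?S = "{X \<in> lat H n. codim X = p \<and> \<not> H k \<preceq> X}"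
  let ?A = "\<lambda>X. {Xs. is_flag H n p Xs \<and> last Xs = X}"
  have finS: "finite ?S" using finite_lat by simp
  have "dehom_space H n p k =
      {\<Oplus>\<^bsub>flag_space H n\<^esub> X\<in>?S. g X | g. g \<in> (\<Pi> X\<in>?S. flag_proj H n ` carrier (free_module (?A X)))}"
    by (simp only: dehom_space_def Let_def flag_comp_eq)
  also have "\<dots> = flag_proj H n ` {\<Sum>X\<in>?S. f X | f. f \<in> (\<Pi> X\<in>?S. carrier (free_module (?A X)))}"
    by (intro sums_flag_proj_image finS carrier_free_module_mono is_flag_subset_flags)
  also have "\<dots> = flag_proj H n ` carrier (free_module (\<Union>X\<in>?S. ?A X))"
    by (simp only: carrier_free_module_UN[OF finS])
  also have "(\<Union>X\<in>?S. ?A X) = {Xs. is_flag H n p Xs \<and> \<not> H k \<preceq> last Xs}"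
    using last_flag_in_lat codim_last_flag by (auto simp: is_flag_iff)
  finally show ?thesis .
qed

lemma flag_class_in_dehom_space:
  "is_flag H n p Xs \<Longrightarrow> \<not> H k \<preceq> last Xs \<Longrightarrow> flag_class H n Xs \<in> dehom_space H n p k"
  unfolding dehom_space_eq flag_class_def by (intro imageI basis_elt_in_carrier) simp

end

subsection \<open>A left inverse of the differential\<close>

locale arrangement_hyperplane = arrangement H n
  for H :: "nat \<Rightarrow> (complex ^ 'm) set" and n +
  fixes j :: nat
  assumes j: "j \<le> n"
begin

text \<open>Up to the sign \<open>(-1)\<^sup>q\<close>, \<open>lift As [C\<^sub>1, \<dots>, C\<^sub>q]\<close> is the sum of all flags \<open>As @ [Y\<^sub>1, \<dots>, Y\<^sub>q]\<close>
  with \<open>Y\<^sub>s \<inter> H j = C\<^sub>s\<close> and no \<open>Y\<^sub>s\<close> contained in \<open>H j\<close>.\<close>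

primrec lift ::
    "(complex ^ 'm) set list \<Rightarrow> (complex ^ 'm) set list \<Rightarrow> (complex ^ 'm) set list \<Rightarrow> complex"
  where
    "lift As [] = basis_elt As"
  | "lift As (C # Cs) =
      - (\<Sum>Y | last As \<prec>\<cdot> Y \<and> \<not> Y \<subseteq> H j \<and> Y \<inter> H j = C. lift (As @ [Y]) Cs)"

definition retract :: "(complex ^ 'm) set list \<Rightarrow> (complex ^ 'm) set list \<Rightarrow> complex"
  where "retract Xs = (case dropWhile (\<lambda>X. \<not> X \<subseteq> H j) Xs of
      [] \<Rightarrow> 0
    | C # Cs \<Rightarrow> lift (takeWhile (\<lambda>X. \<not> X \<subseteq> H j) Xs) Cs)"

lemma retract_append:
  assumes As: "As \<in> flags H n" "\<not> last As \<subseteq> H j" and "C \<subseteq> H j"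
  shows "retract (As @ C # Cs) = lift As Cs"
proof -
  have "\<forall>A\<in>set As. \<not> A \<subseteq> H j" using last_flag_subset[OF As(1)] As(2) by blast
  then show ?thesis using assms(3) by (simp add: retract_def)
qed

lemma retract_eq_0:
  assumes Xs: "Xs \<in> flags H n" "\<not> last Xs \<subseteq> H j"
  shows "retract Xs = 0"
proof -
  have "dropWhile (\<lambda>X. \<not> X \<subseteq> H j) Xs = []"
    using last_flag_subset[OF Xs(1)] Xs(2) by (auto simp: dropWhile_eq_Nil_conv)
  then show ?thesis by (simp only: retract_def list.case)
qed

lemma sum_lift_insert_prefix_in_flag_rel_span:
  assumes "As \<noteq> []" "Bs \<noteq> []"
  shows "(\<Sum>Y | As @ Y # Bs \<in> flags H n. lift (As @ Y # Bs) Cs) \<in> flag_rel_span H n"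
  using assms(2)
proof (induction Cs arbitrary: Bs)
  case Nil
  then show ?case using flag_relation_in_flag_rel_span[OF assms(1)] by (simp add: flag_relation_def)
next
  case (Cons C Cs)
  let ?Z = "{Z. last Bs \<prec>\<cdot> Z \<and> \<not> Z \<subseteq> H j \<and> Z \<inter> H j = C}"
  have "(\<Sum>Y | As @ Y # Bs \<in> flags H n. lift (As @ Y # Bs) (C # Cs)) =
      - (\<Sum>Z\<in>?Z. \<Sum>Y | As @ Y # Bs \<in> flags H n. lift (As @ Y # Bs @ [Z]) Cs)"
    using Cons.prems by (subst sum.swap) (simp add: sum_negf)
  also have "\<dots> = - (\<Sum>Z\<in>?Z. \<Sum>Y | As @ Y # (Bs @ [Z]) \<in> flags H n. lift (As @ Y # (Bs @ [Z])) Cs)"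
    using Cons.prems assms(1)
    by (intro arg_cong[where f = uminus] sum.cong)
      (auto simp: flags_insert_iff successively_append_iff)
  also have "\<dots> \<in> flag_rel_span H n"
    by (intro flag_rel_span_neg flag_rel_span_sum Cons.IH) simp
  finally show ?case .
qed

lemma sum_lift_insert_first_in_flag_rel_span:
  assumes As: "As \<in> flags H n" "\<not> last As \<subseteq> H j"
  shows "(\<Sum>X | last As \<inter> H j \<prec>\<cdot> X \<and> X \<prec>\<cdot> Q. lift As (X # Q # Qs)) \<in> flag_rel_span H n"
proof -
  let ?A = "last As"
  let ?Y = "{Y. ?A \<prec>\<cdot> Y \<and> \<not> Y \<subseteq> H j \<and> Y \<inter> H j \<prec>\<cdot> Q}"
  let ?Z = "{Z \<in> lat H n. \<not> Z \<subseteq> H j \<and> Z \<inter> H j = Q}"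
  let ?t = "\<lambda>Y Z. lift (As @ [Y, Z]) Qs"
  have Int_covered: "?A \<inter> H j \<prec>\<cdot> Y \<inter> H j" if "?A \<prec>\<cdot> Y" "\<not> Y \<subseteq> H j" for Y
    using that j by (intro covered_by_Int_Int_hyperplane)
  have between: "{Y. Y \<in> ?Y \<and> Y \<prec>\<cdot> Z} = {Y. As @ Y # [Z] \<in> flags H n}" if Z: "Z \<in> ?Z" for Z
  proof -
    have "\<not> Y \<subseteq> H j \<and> Y \<inter> H j \<prec>\<cdot> Q" if "Y \<prec>\<cdot> Z" for Y
      using covered_by_Int_Int_hyperplane[OF that j] covered_by_subset[OF that] Z by auto
    then show ?thesis using As(1) flags_nonempty[OF As(1)] by (auto simp: flags_insert_iff)
  qed
  have "(\<Sum>X | ?A \<inter> H j \<prec>\<cdot> X \<and> X \<prec>\<cdot> Q. lift As (X # Q # Qs)) =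
      (\<Sum>X | ?A \<inter> H j \<prec>\<cdot> X \<and> X \<prec>\<cdot> Q. \<Sum>Y | Y \<in> ?Y \<and> Y \<inter> H j = X. - lift (As @ [Y]) (Q # Qs))"
    unfolding lift.simps(2)[of As] sum_negf[symmetric] by (intro sum.cong) auto
  also have "\<dots> = (\<Sum>Y\<in>?Y. - lift (As @ [Y]) (Q # Qs))"
    using Int_covered by (intro sum.group) auto
  also have "\<dots> = (\<Sum>Y\<in>?Y. \<Sum>Z | Z \<in> ?Z \<and> Y \<prec>\<cdot> Z. ?t Y Z)"
    by (intro sum.cong) (auto simp: covered_by_iff intro!: sum.cong)
  also have "\<dots> = (\<Sum>Z\<in>?Z. \<Sum>Y | Y \<in> ?Y \<and> Y \<prec>\<cdot> Z. ?t Y Z)"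
    using finite_lat by (intro sum.swap_restrict) simp_all
  also have "\<dots> = (\<Sum>Z\<in>?Z. \<Sum>Y | As @ Y # [Z] \<in> flags H n. ?t Y Z)"
    by (intro sum.cong between refl)
  also have "\<dots> \<in> flag_rel_span H n"
  proof (rule flag_rel_span_sum)
    fix Z
    show "(\<Sum>Y | As @ Y # [Z] \<in> flags H n. ?t Y Z) \<in> flag_rel_span H n"
      using sum_lift_insert_prefix_in_flag_rel_span[OF flags_nonempty[OF As(1)], of "[Z]" Qs]
      by simp
  qed
  finally show ?thesis .
qed

lemma sum_lift_insert_suffix_in_flag_rel_span:
  assumes "As \<in> flags H n" "\<not> last As \<subseteq> H j" and "Qs \<noteq> []"
  shows "(\<Sum>X | successively (\<prec>\<cdot>) ((last As \<inter> H j) # Cs @ X # Qs). lift As (Cs @ X # Qs))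
    \<in> flag_rel_span H n"
  using assms(1,2)
proof (induction Cs arbitrary: As)
  case Nil
  obtain Q Qs' where Qs: "Qs = Q # Qs'" using assms(3) by (cases Qs) auto
  show ?case
  proof (cases "successively (\<prec>\<cdot>) Qs")
    case True
    then show ?thesis
      using sum_lift_insert_first_in_flag_rel_span[OF Nil, of Q Qs']
      by (simp add: Qs del: lift.simps)
  next
    case False
    then have "{X. successively (\<prec>\<cdot>) ((last As \<inter> H j) # [] @ X # Qs)} = {}" using Qs by simp
    then show ?thesis using zero_in_flag_rel_span by (simp only: sum.empty)
  qed
next
  case (Cons C Cs)
  let ?X = "{X. successively (\<prec>\<cdot>) ((last As \<inter> H j) # (C # Cs) @ X # Qs)}"
  let ?Y = "{Y. last As \<prec>\<cdot> Y \<and> \<not> Y \<subseteq> H j \<and> Y \<inter> H j = C}"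
  have "(\<Sum>X\<in>?X. lift As ((C # Cs) @ X # Qs)) = - (\<Sum>Y\<in>?Y. \<Sum>X\<in>?X. lift (As @ [Y]) (Cs @ X # Qs))"
    by (subst sum.swap) (simp add: sum_negf)
  also have "\<dots> \<in> flag_rel_span H n"
  proof (intro flag_rel_span_neg flag_rel_span_sum[of ?Y])
    fix Y assume Y: "Y \<in> ?Y"
    then have "last As \<inter> H j \<prec>\<cdot> C" using covered_by_Int_Int_hyperplane[of "last As" Y j] j by auto
    then have "?X = {X. successively (\<prec>\<cdot>) ((last (As @ [Y]) \<inter> H j) # Cs @ X # Qs)}" using Y by simp
    moreover have "As @ [Y] \<in> flags H n"
      using Y Cons.prems by (simp add: flags_snoc_iff flags_nonempty)
    ultimately show "(\<Sum>X\<in>?X. lift (As @ [Y]) (Cs @ X # Qs)) \<in> flag_rel_span H n"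
      using Cons.IH[of "As @ [Y]"] Y by simp
  qed
  finally show ?case .
qed

lemma sum_retract_insert_inside_in_flag_rel_span:
  assumes nonempty: "As \<noteq> []" "Bs \<noteq> []" and subset: "last As \<subseteq> H j"
  shows "(\<Sum>Y | As @ Y # Bs \<in> flags H n. retract (As @ Y # Bs)) \<in> flag_rel_span H n"
proof (cases "As \<in> flags H n")
  case True
  obtain Ps C Cs where As: "As = Ps @ C # Cs" and C: "C \<subseteq> H j" and Ps: "\<forall>P\<in>set Ps. \<not> P \<subseteq> H j"
    using split_list_first_propE[of As "\<lambda>X. X \<subseteq> H j"] subset last_in_set[OF nonempty(1)] by metis
  have "\<not> hd As \<subseteq> H j" using True j by (intro codim_0_not_subset_hyperplane) (auto simp: flags_iff)
  then have Ps_ne: "Ps \<noteq> []" using As C by auto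
  then have Ps_flag: "Ps \<in> flags H n" "last Ps \<prec>\<cdot> C" using True by (auto simp: As flags_append_iff)
  have not_subset: "\<not> last Ps \<subseteq> H j" using Ps Ps_ne by simp
  have C_eq: "C = last Ps \<inter> H j" using covered_by_eq_Int_hyperplane[OF Ps_flag(2) j not_subset C] .
  have "As @ Y # Bs \<in> flags H n \<longleftrightarrow> successively (\<prec>\<cdot>) (C # Cs @ Y # Bs)" for Y
    using flags_append_iff[OF Ps_ne, of "C # Cs @ Y # Bs"] Ps_flag by (simp add: As)
  then show ?thesis
    using sum_lift_insert_suffix_in_flag_rel_span[OF Ps_flag(1) not_subset nonempty(2), of Cs]
      retract_append[OF Ps_flag(1) not_subset C] by (simp add: As C_eq)
next
  case False
  then have none: "{Y. As @ Y # Bs \<in> flags H n} = {}" using nonempty by (simp add: flags_insert_iff)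
  show ?thesis unfolding none by (simp add: zero_in_flag_rel_span)
qed

text \<open>The only \<open>Y\<close> contained in \<open>H j\<close> is \<open>last As \<inter> H j\<close>; its term cancels against the sum of all
  others by the recursion for \<open>lift\<close>.\<close>

lemma sum_retract_insert_crossing_eq_0:
  assumes nonempty: "As \<noteq> []" and not_subset: "\<not> last As \<subseteq> H j" and subset: "B \<subseteq> H j"
  shows "(\<Sum>Y | As @ Y # B # Bs \<in> flags H n. retract (As @ Y # B # Bs)) = 0"
proof (cases "\<exists>Y. As @ Y # B # Bs \<in> flags H n")
  case True
  let ?I = "last As \<inter> H j"
  let ?Y = "{Y. As @ Y # B # Bs \<in> flags H n}" and ?N = "{Y. last As \<prec>\<cdot> Y \<and> \<not> Y \<subseteq> H j \<and> Y \<inter> H j = B}"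
  obtain Y where As: "As \<in> flags H n" and Y: "last As \<prec>\<cdot> Y" "Y \<prec>\<cdot> B"
    and Bs: "successively (\<prec>\<cdot>) (B # Bs)"
    using True nonempty by (auto simp: flags_insert_iff)
  have Int_covers: "last As \<prec>\<cdot> ?I"
    using Y not_subset j by (intro covered_by_Int_hyperplane) (simp_all add: covered_by_iff)
  have "?I \<prec>\<cdot> B" using Y Int_covers subset by (auto simp: covered_by_iff)
  moreover have "Y \<subseteq> H j \<longleftrightarrow> Y = ?I" if "last As \<prec>\<cdot> Y" for Y
    using covered_by_eq_Int_hyperplane[OF that j not_subset] by auto
  moreover have "Y \<prec>\<cdot> B \<longleftrightarrow> Y \<inter> H j = B" if "last As \<prec>\<cdot> Y" "\<not> Y \<subseteq> H j" for Y
    using covered_by_eq_Int_hyperplane[of Y B j] covered_by_Int_hyperplane[of Y j] that j subset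
    by (auto simp: covered_by_iff)
  ultimately have "As @ Y # B # Bs \<in> flags H n \<longleftrightarrow> Y = ?I \<or> Y \<in> ?N" for Y
    using As Bs nonempty Int_covers
    by (cases "last As \<prec>\<cdot> Y"; cases "Y \<subseteq> H j") (auto simp: flags_insert_iff)
  then have "?Y = insert ?I ?N" by blast
  moreover have "?I \<notin> ?N" by blast
  ultimately have "(\<Sum>Y\<in>?Y. retract (As @ Y # B # Bs)) =
      retract (As @ ?I # B # Bs) + (\<Sum>Y\<in>?N. retract (As @ Y # B # Bs))"
    using finite_covered_by(1) by (simp only: sum.insert not_False_eq_True)
  also have "retract (As @ ?I # B # Bs) = lift As (B # Bs)"
    by (intro retract_append As not_subset Int_lower2)
  also have "(\<Sum>Y\<in>?N. retract (As @ Y # B # Bs)) = (\<Sum>Y\<in>?N. lift (As @ [Y]) Bs)"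
  proof (intro sum.cong refl)
    fix Y assume "Y \<in> ?N"
    then show "retract (As @ Y # B # Bs) = lift (As @ [Y]) Bs"
      using retract_append[of "As @ [Y]" B Bs] As nonempty subset by (simp add: flags_snoc_iff)
  qed
  finally show ?thesis by (simp only: lift.simps left_minus)
qed simp

lemma sum_retract_insert_outside_in_flag_rel_span:
  assumes nonempty: "As \<noteq> []" "Bs \<noteq> []" and not_subset: "\<not> hd Bs \<subseteq> H j"
  shows "(\<Sum>Y | As @ Y # Bs \<in> flags H n. retract (As @ Y # Bs)) \<in> flag_rel_span H n"
proof (cases "last Bs \<subseteq> H j")
  case True
  obtain Ps C Cs where Bs: "Bs = Ps @ C # Cs" and C: "C \<subseteq> H j" and Ps: "\<forall>P\<in>set Ps. \<not> P \<subseteq> H j"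
    using split_list_first_propE[of Bs "\<lambda>X. X \<subseteq> H j"] True last_in_set[OF nonempty(2)] by metis
  have Ps_ne: "Ps \<noteq> []" using Bs C not_subset by auto
  have split: "As @ Y # Bs \<in> flags H n \<longleftrightarrow>
      As @ Y # Ps \<in> flags H n \<and> last Ps \<prec>\<cdot> C \<and> successively (\<prec>\<cdot>) (C # Cs)" for Y
    using flags_append_iff[of "As @ Y # Ps" "C # Cs"] Ps_ne by (simp add: Bs)
  have "retract (As @ Y # Bs) = lift (As @ Y # Ps) Cs" if "As @ Y # Bs \<in> flags H n" for Y
    using retract_append[of "As @ Y # Ps" C Cs] that split C Ps Ps_ne by (simp add: Bs)
  then have "(\<Sum>Y | As @ Y # Bs \<in> flags H n. retract (As @ Y # Bs)) =
      (\<Sum>Y | As @ Y # Bs \<in> flags H n. lift (As @ Y # Ps) Cs)"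
    by (intro sum.cong) simp_all
  also have "\<dots> \<in> flag_rel_span H n"
  proof (cases "last Ps \<prec>\<cdot> C \<and> successively (\<prec>\<cdot>) (C # Cs)")
    case True
    then have "{Y. As @ Y # Bs \<in> flags H n} = {Y. As @ Y # Ps \<in> flags H n}" by (simp add: split)
    then show ?thesis using sum_lift_insert_prefix_in_flag_rel_span[OF nonempty(1) Ps_ne] by simp
  next
    case False
    then have "{Y. As @ Y # Bs \<in> flags H n} = {}" by (simp add: split)
    then show ?thesis using zero_in_flag_rel_span by (simp only: sum.empty)
  qed
  finally show ?thesis .
next
  case False
  then have "retract (As @ Y # Bs) = 0" if "As @ Y # Bs \<in> flags H n" for Y
    using nonempty that by (intro retract_eq_0) simp_all
  then show ?thesis using zero_in_flag_rel_span by simp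
qed

definition chain_retract ::
    "((complex ^ 'm) set list \<Rightarrow> complex) \<Rightarrow> (complex ^ 'm) set list \<Rightarrow> complex"
  where "chain_retract = linear_extension (flags H n) retract"

lemma linear_chain_retract: "fun_linear chain_retract"
  unfolding chain_retract_def by (rule linear_linear_extension)

lemma chain_retract_basis_elt: "Xs \<in> flags H n \<Longrightarrow> chain_retract (basis_elt Xs) = retract Xs"
  unfolding chain_retract_def by (rule linear_extension_basis_elt[OF finite_flags])

lemma chain_retract_flag_rel_span:
  assumes "c \<in> flag_rel_span H n"
  shows "chain_retract c \<in> flag_rel_span H n"
  using linear_chain_retract _ assms
proof (rule linear_image_flag_rel_span)
  fix As Bs :: "(complex ^ 'm) set list" assume nonempty: "As \<noteq> []" "Bs \<noteq> []"
  obtain B Bs' where Bs: "Bs = B # Bs'" using nonempty(2) by (cases Bs) auto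
  have eq: "chain_retract (flag_relation As Bs) =
      (\<Sum>Y | As @ Y # Bs \<in> flags H n. retract (As @ Y # Bs))"
    unfolding flag_relation_def fun_space_pair.linear_sum[OF linear_chain_retract]
    by (simp add: chain_retract_basis_elt)
  consider (inside) "last As \<subseteq> H j" | (crossing) "\<not> last As \<subseteq> H j" "B \<subseteq> H j" | (outside) "\<not> B \<subseteq> H j"
    by blast
  then show "chain_retract (flag_relation As Bs) \<in> flag_rel_span H n"
    unfolding eq
  proof cases
    case inside
    then show "(\<Sum>Y | As @ Y # Bs \<in> flags H n. retract (As @ Y # Bs)) \<in> flag_rel_span H n"
      by (rule sum_retract_insert_inside_in_flag_rel_span[OF nonempty])
  next
    case crossing
    have "(\<Sum>Y | As @ Y # Bs \<in> flags H n. retract (As @ Y # Bs)) = 0"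
      unfolding Bs by (rule sum_retract_insert_crossing_eq_0[OF nonempty(1) crossing])
    then show "(\<Sum>Y | As @ Y # Bs \<in> flags H n. retract (As @ Y # Bs)) \<in> flag_rel_span H n"
      using zero_in_flag_rel_span by simp
  next
    case outside
    then show "(\<Sum>Y | As @ Y # Bs \<in> flags H n. retract (As @ Y # Bs)) \<in> flag_rel_span H n"
      by (intro sum_retract_insert_outside_in_flag_rel_span nonempty) (simp add: Bs)
  qed
qed

lemma chain_retract_coboundary:
  assumes Xs: "Xs \<in> flags H n" and not_subset: "\<not> last Xs \<subseteq> H j"
  shows "chain_retract (coboundary Xs) = basis_elt Xs"
proof -
  have nonempty: "Xs \<noteq> []" using Xs by (rule flags_nonempty)
  have Int_covers: "last Xs \<prec>\<cdot> last Xs \<inter> H j"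
    by (intro covered_by_Int_hyperplane last_flag_in_lat Xs j not_subset)
  have "chain_retract (coboundary Xs) = (\<Sum>X | last Xs \<prec>\<cdot> X. retract (Xs @ [X]))"
    unfolding coboundary_def fun_space_pair.linear_sum[OF linear_chain_retract]
    using Xs nonempty by (intro sum.cong) (simp_all add: chain_retract_basis_elt flags_snoc_iff)
  also have "\<dots> = (\<Sum>X | last Xs \<prec>\<cdot> X. if X = last Xs \<inter> H j then basis_elt Xs else 0)"
  proof (intro sum.cong refl)
    fix X assume "X \<in> {X. last Xs \<prec>\<cdot> X}"
    then have X: "last Xs \<prec>\<cdot> X" by simp
    show "retract (Xs @ [X]) = (if X = last Xs \<inter> H j then basis_elt Xs else 0)"
    proof (cases "X \<subseteq> H j")
      case True
      then have "X = last Xs \<inter> H j" by (rule covered_by_eq_Int_hyperplane[OF X j not_subset])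
      moreover have "retract (Xs @ [X]) = basis_elt Xs"
        by (simp add: retract_append[OF Xs not_subset True])
      ultimately show ?thesis by simp
    next
      case False
      then have "retract (Xs @ [X]) = 0"
        using Xs nonempty X by (intro retract_eq_0) (simp_all add: flags_snoc_iff)
      then show ?thesis using False by auto
    qed
  qed
  also have "\<dots> = basis_elt Xs" using Int_covers by simp
  finally show ?thesis .
qed

lemma chain_retract_chain_diff:
  assumes "f \<in> carrier (free_module {Xs \<in> flags H n. \<not> last Xs \<subseteq> H j})"
  shows "chain_retract (chain_diff f) = f"
proof -
  let ?B = "basis_elt ` {Xs \<in> flags H n. \<not> last Xs \<subseteq> H j}"
  have "fun_linear (chain_retract \<circ> chain_diff)"
    by (rule Vector_Spaces.linear_compose[OF linear_chain_diff linear_chain_retract])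
  then have "(chain_retract \<circ> chain_diff) f = (\<lambda>f. f) f"
  proof (rule fun_space_pair.linear_eq_on[OF _ fun_space.linear_ident])
    show "f \<in> fun_space.span ?B" using assms by (simp add: carrier_free_module)
    fix b assume "b \<in> ?B"
    then obtain Xs where "Xs \<in> flags H n" "\<not> last Xs \<subseteq> H j" "b = basis_elt Xs" by blast
    then show "(chain_retract \<circ> chain_diff) b = b"
      by (simp add: chain_diff_basis_elt chain_retract_coboundary)
  qed
  then show ?thesis by simp
qed

lemma inj_on_red_proj_dehom_space: "inj_on (red_proj H n) (dehom_space H n p j)"
proof (rule inj_onI)
  let ?C = "carrier (free_module {Xs. is_flag H n p Xs \<and> \<not> H j \<preceq> last Xs})"
  fix F G assume "F \<in> dehom_space H n p j" "G \<in> dehom_space H n p j"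
    and eq: "red_proj H n F = red_proj H n G"
  then obtain f g where f: "F = flag_proj H n f" "f \<in> ?C" and g: "G = flag_proj H n g" "g \<in> ?C"
    by (auto simp: dehom_space_eq)
  have "?C \<subseteq> chains" by (intro carrier_free_module_mono is_flag_subset_flags)
  then have chains: "f \<in> chains" "g \<in> chains" using f(2) g(2) by blast+
  then obtain c where c_chain: "c \<in> chains"
    and diff: "f - g - chain_diff c \<in> flag_rel_span H n"
    using eq by (auto simp: f g red_proj_eq_iff)
  have "chain_diff (f - g - chain_diff c) \<in> flag_rel_span H n"
    by (rule chain_diff_flag_rel_span[OF diff])
  then have "chain_diff (f - g) - chain_diff (chain_diff c) \<in> flag_rel_span H n"
    by (simp only: fun_space_pair.linear_diff[OF linear_chain_diff])
  then have "chain_diff (f - g) \<in> flag_rel_span H n"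
    using fun_space.subspace_add[OF subspace_flag_rel_span _ chain_diff_chain_diff[OF c_chain]]
    by fastforce
  then have "chain_retract (chain_diff (f - g)) \<in> flag_rel_span H n"
    by (rule chain_retract_flag_rel_span)
  moreover have "f - g \<in> carrier (free_module {Xs \<in> flags H n. \<not> last Xs \<subseteq> H j})"
    using free_module_diff_closed[OF f(2) g(2)] carrier_free_module_mono[of
        "{Xs. is_flag H n p Xs \<and> \<not> H j \<preceq> last Xs}" "{Xs \<in> flags H n. \<not> last Xs \<subseteq> H j}"]
    by (auto simp: is_flag_iff lat_le_def)
  ultimately have "f - g \<in> flag_rel_span H n" by (simp only: chain_retract_chain_diff)
  then show "F = G" using chains by (simp add: f g flag_proj_eq_iff)
qed

subsection \<open>Transition maps\<close>

lemma transition_eqI: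
  assumes "F \<in> dehom_space H n p i" "G \<in> dehom_space H n p j" "red_proj H n G = red_proj H n F"
  shows "transition H n p i j F = G"
proof -
  have "(THE G. G \<in> dehom_space H n p j \<and> red_proj H n G = red_proj H n F) = G"
    using assms inj_onD[OF inj_on_red_proj_dehom_space] by (intro the_equality) metis+
  then show ?thesis using assms(1) by (simp add: transition_def)
qed

lemma transition_flag_class_eq_self:
  assumes "is_flag H n p Xs" "\<not> H i \<preceq> last Xs" "\<not> H j \<preceq> last Xs"
  shows "transition H n p i j (flag_class H n Xs) = flag_class H n Xs"
  using assms by (intro transition_eqI flag_class_in_dehom_space refl)

lemma transition_flag_class_snoc:
  assumes Xs: "is_flag H n p (As @ [X])" and nonempty: "As \<noteq> []" and i: "\<not> H i \<preceq> X"
    and X_le: "H j \<preceq> X" and As_nle: "\<not> H j \<preceq> last As"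
  shows "transition H n p i j (flag_class H n (As @ [X])) =
    \<ominus>\<^bsub>flag_space H n\<^esub> (\<Oplus>\<^bsub>flag_space H n\<^esub> X' \<in> {X'. last As \<prec>\<cdot> X' \<and> X' \<noteq> X}.
      flag_class H n (As @ [X']))"
proof -
  let ?T = "{X'. last As \<prec>\<cdot> X' \<and> X' \<noteq> X}"
  let ?g = "- (\<Sum>X'\<in>?T. basis_elt (As @ [X']))"
  have As: "As \<in> flags H n" "last As \<prec>\<cdot> X" and len: "length As = p"
    using Xs nonempty by (simp_all add: is_flag_iff flags_snoc_iff)
  have "X' = last As \<inter> H j" if "last As \<prec>\<cdot> X'" "H j \<preceq> X'" for X'
    using covered_by_eq_Int_hyperplane[OF that(1) j] that(2) As_nle by (simp add: lat_le_def)
  then have T_flag: "is_flag H n p (As @ [X']) \<and> \<not> H j \<preceq> X'" if "X' \<in> ?T" for X'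
    using that As X_le len nonempty by (auto simp: is_flag_iff flags_snoc_iff)
  then have T_chains: "basis_elt (As @ [X']) \<in> chains" if "X' \<in> ?T" for X'
    using that by (simp add: is_flag_iff)
  have sum_chains: "(\<Sum>X'\<in>?T. basis_elt (As @ [X'])) \<in> chains"
    by (rule free_module_sum_closed[OF T_chains])
  have "transition H n p i j (flag_class H n (As @ [X])) = flag_proj H n ?g"
  proof (rule transition_eqI)
    show "flag_class H n (As @ [X]) \<in> dehom_space H n p i"
      using Xs i by (intro flag_class_in_dehom_space) simp_all
    show "flag_proj H n ?g \<in> dehom_space H n p j"
      unfolding dehom_space_eq using T_flag
      by (intro imageI free_module_uminus_closed free_module_sum_closed basis_elt_in_carrier) simp
    have "coboundary As = basis_elt (As @ [X]) - ?g"
      unfolding coboundary_def using As(2) by (simp add: sum.remove[of _ X] set_diff_eq)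
    then have "?g - basis_elt (As @ [X]) - chain_diff (- basis_elt As) = 0"
      by (simp add: fun_space_pair.linear_neg[OF linear_chain_diff] chain_diff_basis_elt As)
    then show "red_proj H n (flag_proj H n ?g) = red_proj H n (flag_class H n (As @ [X]))"
      unfolding flag_class_def using Xs As(1) sum_chains zero_in_flag_rel_span
      by (subst red_proj_eq_iff) (auto simp: is_flag_iff intro!: bexI[of _ "- basis_elt As"])
  qed
  also have "flag_proj H n ?g =
      \<ominus>\<^bsub>flag_space H n\<^esub> (\<Oplus>\<^bsub>flag_space H n\<^esub> X'\<in>?T. flag_class H n (As @ [X']))"
    unfolding flag_class_def flag_proj_uminus[OF sum_chains]
    by (simp only: flag_proj_sum[OF finite_covered_by(1) T_chains])
  finally show ?thesis .
qed

end

theorem theorem6p3: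
  fixes H :: "nat \<Rightarrow> (complex ^ 'm) set"
    and n l p i j :: nat
    and Xs :: "(complex ^ 'm) set list"
  assumes "CARD('m) = l + 1"
    and "central_arrangement H n"
    and "i < j" and "j \<le> n"
    and "1 \<le> p" and "p \<le> l"
    and "is_flag H n p Xs"
    and "\<not> H i \<preceq> Xs ! p"
  shows
    "(\<not> H j \<preceq> Xs ! p \<longrightarrow>
        transition H n p i j (flag_class H n Xs) = flag_class H n Xs) \<and>
     (H j \<preceq> Xs ! p \<and> \<not> H j \<preceq> Xs ! (p - 1) \<longrightarrow>
        transition H n p i j (flag_class H n Xs) =
          \<ominus>\<^bsub>flag_space H n\<^esub>
            (\<Oplus>\<^bsub>flag_space H n\<^esub>
               X' \<in> {X' \<in> lat H n. codim X' = p \<and> Xs ! (p - 1) \<prec> X' \<and> X' \<noteq> Xs ! p}.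
               flag_class H n (take p Xs @ [X'])))"
proof -
  interpret arrangement_hyperplane H n j using assms by unfold_locales
  let ?As = "take p Xs"
  have Xs: "Xs \<in> flags H n" and len: "length Xs = p + 1"
    using assms(7) by (simp_all add: is_flag_iff)
  have split: "?As @ [Xs ! p] = Xs" using len by (simp flip: take_Suc_conv_app_nth)
  have nonempty: "?As \<noteq> []" using len \<open>1 \<le> p\<close> by auto
  have last: "last ?As = Xs ! (p - 1)" "last Xs = Xs ! p"
    using len \<open>1 \<le> p\<close> nonempty flags_nonempty[OF Xs] by (simp_all add: last_conv_nth)
  have "Xs ! (p - 1) \<in> lat H n" "codim (Xs ! (p - 1)) + 1 = p"
    using set_flag_subset_lat[OF Xs] codim_flag_nth[OF Xs, of "p - 1"] len \<open>1 \<le> p\<close> by auto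
  then have covers: "{X' \<in> lat H n. codim X' = p \<and> Xs ! (p - 1) \<prec> X' \<and> X' \<noteq> Xs ! p} =
      {X'. last ?As \<prec>\<cdot> X' \<and> X' \<noteq> Xs ! p}"
    by (auto simp: covered_by_def last)
  show ?thesis
    unfolding covers
    using transition_flag_class_eq_self[OF assms(7), of i] assms(7,8)
      transition_flag_class_snoc[of p ?As "Xs ! p" i, OF _ nonempty] by (simp add: last split)
qed

end
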